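(* Let $u:\mathbb R^{\bar d}\to\mathbb R$ be the transformer pretraining potential defined in the context, with depth $\mathsf L\ge1$, and let $c^\star>0$ be a constant such that $\nabla^2_\theta u(\theta)\succeq-c^\star(1+|\theta|)^{12\mathsf L+2}\mathrm I_{\bar d}$ for a.e. $\theta$. Put $\bar c^\star=2^{12\mathsf L+1}c^\star$. Let $\eta>0$ and $\hat u(\theta)=u(\theta)+\eta|\theta|^{12\mathsf L+5}$. Then, for a.e. $\theta\in\mathbb R^{\bar d}$, $$\nabla^2_\theta\hat u(\theta)\succeq\Big[\big(\eta(12\mathsf L+5)|\theta|-\bar c^\star\big)|\theta|^{12\mathsf L+2}-\bar c^\star\Big]\mathrm I_{\bar d}.$$ Consequently: (i) $\hat u+\frac L2|\cdot|^2$ is convex with $$L=\bar c^\star\left[1+\frac1{12\mathsf L+3}\left(\frac{(12\mathsf L+2)\bar c^\star}{(12\mathsf L+3)\,\eta\,(12\mathsf L+5)}\right)^{12\mathsf L+2}\right];$$ (ii) for every $\mu>0$, $\nabla^2_\theta\hat u(\theta)\succeq\mu\,\mathrm I_{\bar d}$ for a.e. $\theta$ in $\{|\theta|\ge\varrho(\mu)\}$, where $$\varrho(\mu)=\max\left\{\frac{2\bar c^\star}{\eta(12\mathsf L+5)},\ \Big(\frac{2(\bar c^\star+\mu)}{\eta(12\mathsf L+5)}\Big)^{1/(12\mathsf L+3)}\right\};$$ (iii) for every $\mu>0$, with $R=4\varrho(\mu)(\mu+L)/\mu$, every selection $h$ of $\partial\hat u$ satisfies $\langle h(\theta)-h(\theta'),\theta-\theta'\rangle\ge\frac\mu2|\theta-\theta'|^2$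 for all $\theta,\theta'\in\mathbb R^{\bar d}$ with $|\theta-\theta'|\ge R$.
   Context: $A\succeq B$ means $A-B$ is positive semi-definite. For an $L$-semi-convex function $\hat u$, $\partial\hat u(\theta)=\{g:\hat u(\theta')\ge\hat u(\theta)+\langle g,\theta'-\theta\rangle-\frac L2|\theta'-\theta|^2\ \forall\theta'\}$; a selection is a map $h$ with $h(\theta)\in\partial\hat u(\theta)$. Constants: positive integers $\mathsf L$ (depth), $d_{\mathrm m}$ (width), $H$ (heads) with $d_{\mathrm h}=d_{\mathrm m}/H$ an integer, $V$ (vocabulary size), $T$ (context length), $d_{\mathrm f}=4d_{\mathrm m}$; reals $\varepsilon,\tau,c_{qk}>0$. Parameter: $\theta=(E,\{W_Q^\ell,W_K^\ell,W_V^\ell,W_O^\ell,W_1^\ell,W_2^\ell\}_{\ell=1}^{\mathsf L},W_{\mathrm{lm}})\in\mathbb R^{\bar d}$ with $E,W_{\mathrm{lm}}\in\mathbb R^{V\times d_{\mathrm m}}$, $W_Q^\ell,W_K^\ell,W_V^\ell,W_O^\ell\in\mathbb R^{d_{\mathrm m}\times d_{\mathrm m}}$, $W_1^\ell\in\mathbb R^{d_{\mathrm f}\times d_{\mathrm m}}$, $W_2^\ell\in\mathbb R^{d_{\mathrm m}\times d_{\mathrm f}}$, so $\bar d=2Vd_{\mathrm m}+12\mathsf L d_{\mathrm m}^2$, and $|\theta|$ is the Euclidean norm. $W_{Q,i}^\ell\in\mathbb R^{d_{\mathrm h}\times d_{\mathrm m}}$, $i=1,\dots,H$, is the $i$-th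 block of $d_{\mathrm h}$ rows of $W_Q^\ell$; likewise for $K,V$. Nonlinearities: $\mathrm N_k(x)=x/(\frac1k|x|^2+\varepsilon)^{1/2}$ for $x\in\mathbb R^k$; $\mathrm{sm}(z)_i=e^{z_i}/\sum_je^{z_j}$; $\chi(z)=\tau\tanh(z/\tau)$ and $\varphi(z)=\max(z,0)^2$, both acting componentwise. Data: a token sequence $x=(x_0,\dots,x_T)\in\{1,\dots,V\}^{T+1}$ with inputs $x_0,\dots,x_{T-1}$ and targets $y_t=x_{t+1}$, $t=0,\dots,T-1$; $\mathcal D$ is a probability distribution on such sequences. $R_t\in\mathbb R^{d_{\mathrm h}\times d_{\mathrm h}}$ are fixed orthogonal matrices; $\mathcal S_\ell(t)\subseteq\{0,\dots,t\}$ are fixed nonempty attention windows. Forward map: $f^0_t=E^\top e_{x_t}\in\mathbb R^{d_{\mathrm m}}$. For $\ell=1,\dots,\mathsf L$: $\bar g_t^\ell=\mathrm N_{d_{\mathrm m}}(f_t^{\ell-1})$; $q_{t,i}^\ell=R_t\mathrm N_{d_{\mathrm h}}(W_{Q,i}^\ell\bar g_t^\ell)$, $k_{s,i}^\ell=R_s\mathrm N_{d_{\mathrm h}}(W_{K,i}^\ell\bar g_s^\ell)$; $a_{t,s,i}^\ell=\frac{c_{qk}}{\sqrt{d_{\mathrm h}}}\langle q_{t,i}^\ell,k_{s,i}^\ell\rangle$, $s\in\mathcal S_\ell(t)$; $p_{t,\cdot,i}^\ell=\mathrm{sm}(a_{t,\cdot,i}^\ell)$; $v_{s,i}^\ell=W_{V,i}^\ell\bar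 g_s^\ell$; $o_t^\ell=W_O^\ell\big(\bigoplus_{i=1}^H\sum_{s\in\mathcal S_\ell(t)}p_{t,s,i}^\ell v_{s,i}^\ell\big)$ (concatenation over $i$); $f_t^{\ell-1/2}=f_t^{\ell-1}+o_t^\ell$; $\bar b_t^\ell=\mathrm N_{d_{\mathrm m}}(f_t^{\ell-1/2})$; $m_t^\ell=W_2^\ell\varphi(W_1^\ell\bar b_t^\ell)$; $f_t^\ell=f_t^{\ell-1/2}+m_t^\ell$. Head: $z_t=\mathrm N_{d_{\mathrm m}}(f_t^{\mathsf L})$, $\zeta_t=W_{\mathrm{lm}}z_t\in\mathbb R^V$, $\hat\zeta_t=\chi(\zeta_t)$. Potential: $u(\theta)=\mathbb E_{x\sim\mathcal D}\big[\frac1T\sum_{t=0}^{T-1}\big(\log\sum_{j=1}^Ve^{\hat\zeta_{t,j}(\theta)}-\hat\zeta_{t,y_t}(\theta)\big)\big]$. A constant $c^\star$ as in the claim exists (it is the constant of the paper's curvature bound for $u$). *)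

theory Defs
  imports "HOL-Analysis.Analysis" "HOL-Probability.Probability"
begin

section \<open>Hessians, the Loewner order and semi-convex subdifferentials\<close>

text \<open>
  The Hessian of a real function on a Euclidean space is the Frechet derivative of its gradient,
  as a linear operator. It is a pointwise notion (gradient near the point, differentiable at the
  point), as needed for functions that are twice differentiable only almost everywhere.
\<close>

definition has_hessian :: "('a::euclidean_space \<Rightarrow> real) \<Rightarrow> ('a \<Rightarrow> 'a) \<Rightarrow> 'a \<Rightarrow> bool" where
  "has_hessian f A x \<longleftrightarrow>
     (\<exists>g. (\<forall>\<^sub>F y in nhds x. GDERIV f y :> g y) \<and> (g has_derivative A) (at x))"

definition psd :: "('a::euclidean_space \<Rightarrow> 'a) \<Rightarrow> bool" where
  "psd A \<longleftrightarrow> linear A \<and> (\<forall>v w. A v \<bullet> w = v \<bullet> A w) \<and> (\<forall>v. 0 \<le> v \<bullet> A v)"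

definition loewner_ge :: "('a::euclidean_space \<Rightarrow> 'a) \<Rightarrow> ('a \<Rightarrow> 'a) \<Rightarrow> bool" where
  "loewner_ge A B \<longleftrightarrow> psd (\<lambda>v. A v - B v)"

text \<open>The Hessian of \<open>f\<close> exists at \<open>x\<close> and dominates \<open>c\<close> times the identity.\<close>

definition hessian_ge :: "('a::euclidean_space \<Rightarrow> real) \<Rightarrow> 'a \<Rightarrow> real \<Rightarrow> bool" where
  "hessian_ge f x c \<longleftrightarrow> (\<exists>A. has_hessian f A x \<and> loewner_ge A (\<lambda>v. c *\<^sub>R v))"

definition semiconvex_subdiff :: "real \<Rightarrow> ('a::euclidean_space \<Rightarrow> real) \<Rightarrow> 'a \<Rightarrow> 'a set" where
  "semiconvex_subdiff L f x =
     {g. \<forall>y. f y \<ge> f x + g \<bullet> (y - x) - L / 2 * (norm (y - x))\<^sup>2}"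


section \<open>Transformer parameters\<close>

text \<open>
  Sizes are carried by finite index types: \<open>'h\<close> indexes the heads, \<open>'k\<close> the coordinates inside a
  head, \<open>'v\<close> the vocabulary and \<open>'l\<close> the layers, which are traversed in increasing order. The model
  coordinates are the pairs in \<open>'h \<times> 'k\<close>, so that the rows with first component \<open>i\<close> are the
  \<open>i\<close>-th head block, and the feed-forward coordinates are indexed by \<open>4 \<times> ('h \<times> 'k)\<close>.
  The product norm of \<open>params\<close> is the Euclidean norm of the concatenated entries.
\<close>

type_synonym ('h, 'k) model_vec = "real ^ ('h \<times> 'k)"
type_synonym ('h, 'k) model_mat = "real ^ ('h \<times> 'k) ^ ('h \<times> 'k)"
type_synonym ('h, 'k) up_mat = "real ^ ('h \<times> 'k) ^ (4 \<times> ('h \<times> 'k))"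
type_synonym ('h, 'k) down_mat = "real ^ (4 \<times> ('h \<times> 'k)) ^ ('h \<times> 'k)"
type_synonym ('v, 'h, 'k) vocab_mat = "real ^ ('h \<times> 'k) ^ 'v"

text \<open>The components of a layer are \<open>W\<^sub>Q, W\<^sub>K, W\<^sub>V, W\<^sub>O, W\<^sub>1, W\<^sub>2\<close>.\<close>

type_synonym ('h, 'k) layer_params =
  "('h, 'k) model_mat \<times> ('h, 'k) model_mat \<times> ('h, 'k) model_mat \<times> ('h, 'k) model_mat \<times>
   ('h, 'k) up_mat \<times> ('h, 'k) down_mat"

type_synonym ('l, 'v, 'h, 'k) params =
  "('v, 'h, 'k) vocab_mat \<times> (('h, 'k) layer_params ^ 'l) \<times> ('v, 'h, 'k) vocab_mat"

lemma DIM_params: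
  "DIM(('l::finite, 'v::finite, 'h::finite, 'k::finite) params) =
     2 * CARD('v) * CARD('h \<times> 'k) + 12 * CARD('l) * CARD('h \<times> 'k)\<^sup>2"
  by (simp add: power2_eq_square algebra_simps)


section \<open>Forward map\<close>

definition rms_norm :: "real \<Rightarrow> real ^ 'n::finite \<Rightarrow> real ^ 'n" where
  "rms_norm \<epsilon> x = x /\<^sub>R sqrt ((norm x)\<^sup>2 / real CARD('n) + \<epsilon>)"

definition softmax_on :: "'i set \<Rightarrow> ('i \<Rightarrow> real) \<Rightarrow> 'i \<Rightarrow> real" where
  "softmax_on I z i = exp (z i) / (\<Sum>j\<in>I. exp (z j))"

definition softcap :: "real \<Rightarrow> real \<Rightarrow> real" where
  "softcap \<tau> z = \<tau> * tanh (z / \<tau>)"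

definition relu_sq :: "real \<Rightarrow> real" where
  "relu_sq z = (max z 0)\<^sup>2"

definition head_rows :: "real ^ 'n::finite ^ ('h::finite \<times> 'k::finite) \<Rightarrow> 'h \<Rightarrow> real ^ 'n ^ 'k" where
  "head_rows W i = (\<chi> j. W $ (i, j))"

definition concat_heads :: "('h::finite \<Rightarrow> real ^ 'k::finite) \<Rightarrow> ('h, 'k) model_vec" where
  "concat_heads w = (\<chi> r. w (fst r) $ snd r)"

text \<open>
  Below, \<open>g\<close> and \<open>f\<close> are families of model vectors indexed by positions, and \<open>S t\<close> is the
  attention window of position \<open>t\<close> in the current layer. Queries and keys are both given by
  \<open>qk_vec\<close>, with \<open>W\<close> the respective weight matrix.
\<close>

definition qk_vec ::
  "real \<Rightarrow> (nat \<Rightarrow> real ^ 'k::finite ^ 'k) \<Rightarrow> ('h::finite, 'k) model_mat \<Rightarrow> (nat \<Rightarrow> ('h, 'k) model_vec) \<Rightarrow>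
   'h \<Rightarrow> nat \<Rightarrow> real ^ 'k" where
  "qk_vec \<epsilon> R W g i t = R t *v rms_norm \<epsilon> (head_rows W i *v g t)"

definition attn_score ::
  "real \<Rightarrow> real \<Rightarrow> (nat \<Rightarrow> real ^ 'k::finite ^ 'k) \<Rightarrow> ('h::finite, 'k) layer_params \<Rightarrow>
   (nat \<Rightarrow> ('h, 'k) model_vec) \<Rightarrow> 'h \<Rightarrow> nat \<Rightarrow> nat \<Rightarrow> real" where
  "attn_score \<epsilon> c R P g i t s =
     (case P of (WQ, WK, WV, WO, W1, W2) \<Rightarrow>
        c / sqrt (real CARD('k)) * (qk_vec \<epsilon> R WQ g i t \<bullet> qk_vec \<epsilon> R WK g i s))"

definition attn_out ::
  "real \<Rightarrow> real \<Rightarrow> (nat \<Rightarrow> real ^ 'k::finite ^ 'k) \<Rightarrow> (nat \<Rightarrow> nat set) \<Rightarrow> ('h::finite, 'k) layer_params \<Rightarrow>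
   (nat \<Rightarrow> ('h, 'k) model_vec) \<Rightarrow> nat \<Rightarrow> ('h, 'k) model_vec" where
  "attn_out \<epsilon> c R S P g t =
     (case P of (WQ, WK, WV, WO, W1, W2) \<Rightarrow>
        WO *v concat_heads (\<lambda>i. \<Sum>s\<in>S t.
          softmax_on (S t) (attn_score \<epsilon> c R P g i t) s *\<^sub>R (head_rows WV i *v g s)))"

definition mlp_out :: "('h::finite, 'k::finite) layer_params \<Rightarrow> ('h, 'k) model_vec \<Rightarrow> ('h, 'k) model_vec" where
  "mlp_out P b =
     (case P of (WQ, WK, WV, WO, W1, W2) \<Rightarrow> W2 *v (\<chi> r. relu_sq ((W1 *v b) $ r)))"

definition attn_step ::
  "real \<Rightarrow> real \<Rightarrow> (nat \<Rightarrow> real ^ 'k::finite ^ 'k) \<Rightarrow> (nat \<Rightarrow> nat set) \<Rightarrow> ('h::finite, 'k) layer_params \<Rightarrow>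
   (nat \<Rightarrow> ('h, 'k) model_vec) \<Rightarrow> nat \<Rightarrow> ('h, 'k) model_vec" where
  "attn_step \<epsilon> c R S P f t = f t + attn_out \<epsilon> c R S P (\<lambda>s. rms_norm \<epsilon> (f s)) t"

definition layer_step ::
  "real \<Rightarrow> real \<Rightarrow> (nat \<Rightarrow> real ^ 'k::finite ^ 'k) \<Rightarrow> (nat \<Rightarrow> nat set) \<Rightarrow> ('h::finite, 'k) layer_params \<Rightarrow>
   (nat \<Rightarrow> ('h, 'k) model_vec) \<Rightarrow> nat \<Rightarrow> ('h, 'k) model_vec" where
  "layer_step \<epsilon> c R S P f t =
     (let f' = attn_step \<epsilon> c R S P f t in f' + mlp_out P (rms_norm \<epsilon> f'))"

text \<open>\<open>nth_layer n\<close> is the layer with number \<open>n + 1\<close>.\<close>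

definition nth_layer :: "nat \<Rightarrow> 'l::{finite,linorder}" where
  "nth_layer n = sorted_list_of_set (UNIV :: 'l set) ! n"

text \<open>The \<open>v\<close>-th row of \<open>E\<close> is the product of the transpose of \<open>E\<close> with the \<open>v\<close>-th unit vector.\<close>

primrec hidden ::
  "real \<Rightarrow> real \<Rightarrow> (nat \<Rightarrow> real ^ 'k::finite ^ 'k) \<Rightarrow> ('l::{finite,linorder} \<Rightarrow> nat \<Rightarrow> nat set) \<Rightarrow>
   ('l, 'v::finite, 'h::finite, 'k) params \<Rightarrow> 'v list \<Rightarrow> nat \<Rightarrow> nat \<Rightarrow> ('h, 'k) model_vec" where
  "hidden \<epsilon> c R S \<theta> x 0 = (\<lambda>t. fst \<theta> $ (x ! t))"
| "hidden \<epsilon> c R S \<theta> x (Suc n) =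
     layer_step \<epsilon> c R (S (nth_layer n)) (fst (snd \<theta>) $ nth_layer n) (hidden \<epsilon> c R S \<theta> x n)"

definition capped_logit ::
  "real \<Rightarrow> real \<Rightarrow> real \<Rightarrow> (nat \<Rightarrow> real ^ 'k::finite ^ 'k) \<Rightarrow> ('l::{finite,linorder} \<Rightarrow> nat \<Rightarrow> nat set) \<Rightarrow>
   ('l, 'v::finite, 'h::finite, 'k) params \<Rightarrow> 'v list \<Rightarrow> nat \<Rightarrow> 'v \<Rightarrow> real" where
  "capped_logit \<epsilon> \<tau> c R S \<theta> x t j =
     softcap \<tau> ((snd (snd \<theta>) *v rms_norm \<epsilon> (hidden \<epsilon> c R S \<theta> x CARD('l) t)) $ j)"

definition sequence_loss ::
  "real \<Rightarrow> real \<Rightarrow> real \<Rightarrow> (nat \<Rightarrow> real ^ 'k::finite ^ 'k) \<Rightarrow> ('l::{finite,linorder} \<Rightarrow> nat \<Rightarrow> nat set) \<Rightarrow>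
   nat \<Rightarrow> ('l, 'v::finite, 'h::finite, 'k) params \<Rightarrow> 'v list \<Rightarrow> real" where
  "sequence_loss \<epsilon> \<tau> c R S T \<theta> x =
     1 / real T * (\<Sum>t<T. ln (\<Sum>j\<in>UNIV. exp (capped_logit \<epsilon> \<tau> c R S \<theta> x t j))
                          - capped_logit \<epsilon> \<tau> c R S \<theta> x t (x ! (t + 1)))"

definition potential ::
  "real \<Rightarrow> real \<Rightarrow> real \<Rightarrow> (nat \<Rightarrow> real ^ 'k ^ 'k) \<Rightarrow> ('l::{finite,linorder} \<Rightarrow> nat \<Rightarrow> nat set) \<Rightarrow>
   nat \<Rightarrow> 'v list pmf \<Rightarrow> ('l, 'v::finite, 'h::finite, 'k::finite) params \<Rightarrow> real" where
  "potential \<epsilon> \<tau> c R S T D \<theta> =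
     measure_pmf.expectation D (sequence_loss \<epsilon> \<tau> c R S T \<theta>)"

end

(* The loss is built from smooth functions and the squared ReLU, so its gradient is Lipschitz on every
   ball. This is what makes the almost everywhere Hessian bound usable: by Fubini, almost every
   translate of a given segment meets the exceptional set in a null set, along such a segment the
   gradient is Lipschitz and hence increases at least as its almost everywhere derivative says, and
   continuity of the gradient extends the resulting inequality to all segments. The Hessian of
   eta |x|^p dominates eta p |x|^(p-2) I, and (1 + t)^n <= 2^(n-1) (1 + t^n) separates the powers in
   the bound for u. For (i) the scalar lower bound is minimised by weighted AM-GM; for (iii) a segment
   spends length at most 2 rho inside the ball where only the bound -L is available, and h is the
   gradient because uhat is differentiable. *)

theory Submission
  imports Defs
begin

section \<open>Functions with locally Lipschitz gradient\<close>

text \<open>In finite dimension this is local Lipschitz continuity; stated on balls, one constant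
  serves a whole segment.\<close>

definition ball_lipschitz :: "('a::euclidean_space \<Rightarrow> 'b::real_normed_vector) \<Rightarrow> bool" where
  "ball_lipschitz f \<longleftrightarrow> (\<forall>r. \<exists>K. K-lipschitz_on (cball 0 r) f)"

text \<open>The squared ReLU has no second derivative at 0, so C2 is out of reach. A locally
  Lipschitz gradient survives every operation of the network and still allows the almost everywhere
  Hessian to be integrated.\<close>

definition C11 :: "('a::euclidean_space \<Rightarrow> real) \<Rightarrow> bool" where
  "C11 f \<longleftrightarrow> (\<exists>g. (\<forall>x. GDERIV f x :> g x) \<and> ball_lipschitz g)"

section \<open>Closure properties of maps that are Lipschitz on balls\<close>

lemma ball_lipschitz_const: "ball_lipschitz (\<lambda>x. c)"
  unfolding ball_lipschitz_def using lipschitz_on_constant by metis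

lemma ball_lipschitz_id: "ball_lipschitz (\<lambda>x. x)"
  unfolding ball_lipschitz_def using lipschitz_on_id by metis

lemma ball_lipschitz_add:
  "ball_lipschitz f \<Longrightarrow> ball_lipschitz g \<Longrightarrow> ball_lipschitz (\<lambda>x. f x + g x)"
  unfolding ball_lipschitz_def using lipschitz_on_add by metis

lemma ball_lipschitz_continuous_on:
  assumes "ball_lipschitz f" shows "continuous_on S f"
proof -
  have "continuous (at x) f" for x
  proof -
    obtain K where "K-lipschitz_on (cball 0 (norm x + 1)) f"
      using assms unfolding ball_lipschitz_def by blast
    then have "continuous_on (ball 0 (norm x + 1)) f"
      by (rule continuous_on_subset[OF lipschitz_on_continuous_on ball_subset_cball])
    then show ?thesis
      by (simp add: continuous_on_eq_continuous_at)
  qed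
  then show ?thesis
    by (simp add: continuous_at_imp_continuous_on)
qed

lemma ball_lipschitz_bounded:
  assumes "ball_lipschitz f"
  obtains B where "0 \<le> B" "\<And>x. norm x \<le> r \<Longrightarrow> norm (f x) \<le> B"
proof -
  have "bounded (f ` cball 0 r)"
    by (intro compact_imp_bounded compact_continuous_image ball_lipschitz_continuous_on assms) simp
  then obtain B where "\<forall>x\<in>f ` cball 0 r. norm x \<le> B"
    unfolding bounded_iff by blast
  then show thesis
    by (intro that[of "max 0 B"]) (auto simp: le_max_iff_disj)
qed

text \<open>Both factors are bounded on the ball; splitting the difference of products into two
  terms gives the constant B M + K C.\<close>

lemma ball_lipschitz_scaleR:
  assumes "ball_lipschitz f" "ball_lipschitz g"
  shows "ball_lipschitz (\<lambda>x. f x *\<^sub>R g x)"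
  unfolding ball_lipschitz_def
proof
  fix r
  obtain K M where K: "K-lipschitz_on (cball 0 r) f" and M: "M-lipschitz_on (cball 0 r) g"
    using assms unfolding ball_lipschitz_def by metis
  obtain B where B: "0 \<le> B" "\<And>x. norm x \<le> r \<Longrightarrow> norm (f x) \<le> B"
    using ball_lipschitz_bounded[OF assms(1)] by blast
  obtain C where C: "0 \<le> C" "\<And>x. norm x \<le> r \<Longrightarrow> norm (g x) \<le> C"
    using ball_lipschitz_bounded[OF assms(2)] by blast
  have "(B * M + K * C)-lipschitz_on (cball 0 r) (\<lambda>x. f x *\<^sub>R g x)"
  proof (rule lipschitz_onI)
    fix x y :: 'a assume xy: "x \<in> cball 0 r" "y \<in> cball 0 r"
    have "f x *\<^sub>R g x - f y *\<^sub>R g y = f x *\<^sub>R (g x - g y) + (f x - f y) *\<^sub>R g y"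
      by (simp add: algebra_simps)
    then have "norm (f x *\<^sub>R g x - f y *\<^sub>R g y) \<le>
        \<bar>f x\<bar> * norm (g x - g y) + \<bar>f x - f y\<bar> * norm (g y)"
      using norm_triangle_ineq[of "f x *\<^sub>R (g x - g y)" "(f x - f y) *\<^sub>R g y"] by simp
    also have "\<dots> \<le> B * (M * dist x y) + (K * dist x y) * C"
      using xy lipschitz_onD[OF K xy] lipschitz_onD[OF M xy] B C lipschitz_on_nonneg[OF K]
      by (intro add_mono mult_mono) (auto simp: dist_norm)
    finally show "dist (f x *\<^sub>R g x) (f y *\<^sub>R g y) \<le> (B * M + K * C) * dist x y"
      by (simp add: dist_norm algebra_simps)
  qed (use B C lipschitz_on_nonneg[OF K] lipschitz_on_nonneg[OF M] in simp)
  then show "\<exists>K. K-lipschitz_on (cball 0 r) (\<lambda>x. f x *\<^sub>R g x)" by blast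
qed

lemma ball_lipschitz_power:
  fixes f :: "'a::euclidean_space \<Rightarrow> real"
  assumes "ball_lipschitz f" shows "ball_lipschitz (\<lambda>x. f x ^ n)"
proof (induction n)
  case (Suc n)
  then show ?case using ball_lipschitz_scaleR[OF assms Suc] by simp
qed (simp add: ball_lipschitz_const)

lemma ball_lipschitz_norm: "ball_lipschitz norm"
  unfolding ball_lipschitz_def
  by (intro allI exI[of _ 1] lipschitz_onI) (simp_all add: dist_norm norm_triangle_ineq3)

text \<open>The set \<open>I\<close> admits outer functions with a singularity, such as
  \<open>inverse\<close> on the positive reals: the image of a ball is a compact interval inside
  \<open>I\<close> and so stays away from the singularity.\<close>

lemma ball_lipschitz_compose:
  fixes \<phi> :: "real \<Rightarrow> real"
  assumes "ball_lipschitz f" "\<And>x. f x \<in> I"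
    and \<phi>: "\<And>a b. {a..b} \<subseteq> I \<Longrightarrow> \<exists>K. K-lipschitz_on {a..b} \<phi>"
  shows "ball_lipschitz (\<lambda>x. \<phi> (f x))"
  unfolding ball_lipschitz_def
proof
  fix r
  obtain K where K: "K-lipschitz_on (cball 0 r) f"
    using assms(1) unfolding ball_lipschitz_def by blast
  have "connected (f ` cball 0 r) \<and> compact (f ` cball 0 r)"
    by (intro conjI compact_continuous_image connected_continuous_image
        ball_lipschitz_continuous_on assms) auto
  then obtain a b where ab: "f ` cball 0 r = {a..b}"
    unfolding connected_compact_interval_1 by blast
  moreover have "{a..b} \<subseteq> I"
    unfolding ab[symmetric] using assms(2) by blast
  ultimately obtain M where "M-lipschitz_on (f ` cball 0 r) \<phi>"
    using \<phi>[of a b] by metis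
  then show "\<exists>K. K-lipschitz_on (cball 0 r) (\<lambda>x. \<phi> (f x))"
    using lipschitz_on_compose2[OF K] by blast
qed

text \<open>The gradient is bounded on the convex ball, so the mean value inequality applies. The
  product and chain rules need this, because function values multiply gradients there.\<close>

lemma C11_ball_lipschitz:
  assumes "C11 f" shows "ball_lipschitz f"
  unfolding ball_lipschitz_def
proof
  fix r
  obtain g where g: "\<And>x. GDERIV f x :> g x" "ball_lipschitz g"
    using assms unfolding C11_def by blast
  obtain B where B: "0 \<le> B" "\<And>x. norm x \<le> r \<Longrightarrow> norm (g x) \<le> B"
    using ball_lipschitz_bounded[OF g(2)] by blast
  have "B-lipschitz_on (cball 0 r) f"
  proof (rule bounded_derivative_imp_lipschitz)
    fix x :: 'a assume x: "x \<in> cball 0 r"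
    show "(f has_derivative (\<lambda>h. h \<bullet> g x)) (at x within cball 0 r)"
      using g(1)[of x] by (simp add: gderiv_def has_derivative_at_withinI)
    show "onorm (\<lambda>h. h \<bullet> g x) \<le> B"
    proof (rule onorm_le)
      fix h
      have "norm (h \<bullet> g x) \<le> norm h * norm (g x)" by (simp add: Cauchy_Schwarz_ineq2)
      also have "\<dots> \<le> norm h * B" using B(2)[of x] x by (intro mult_left_mono) auto
      finally show "norm (h \<bullet> g x) \<le> B * norm h" by (simp add: mult.commute)
    qed
  qed (use B in auto)
  then show "\<exists>K. K-lipschitz_on (cball 0 r) f" by blast
qed

section \<open>Closure properties of functions with locally Lipschitz gradient\<close>

lemma C11_const: "C11 (\<lambda>x. c)"
  unfolding C11_def by (intro exI[of _ "\<lambda>x. 0"]) (auto intro: GDERIV_const ball_lipschitz_const)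

lemma C11_bounded_linear:
  assumes "bounded_linear f" shows "C11 f"
proof -
  have "linear f" using assms bounded_linear.linear by blast
  \<comment> \<open>The Riesz representative of a linear functional is its adjoint evaluated at
    1.\<close>
  then have "(\<lambda>h. h \<bullet> adjoint f 1) = f"
    by (simp add: adjoint_works)
  then have "GDERIV f x :> adjoint f 1" for x
    unfolding gderiv_def using bounded_linear_imp_has_derivative[OF assms] by simp
  then show ?thesis unfolding C11_def by (intro exI[of _ "\<lambda>x. adjoint f 1"]) (simp add: ball_lipschitz_const)
qed

lemma C11_linear:
  fixes f :: "'a::euclidean_space \<Rightarrow> real"
  assumes "\<And>x y. f (x + y) = f x + f y" "\<And>c x. f (c *\<^sub>R x) = c *\<^sub>R f x"
  shows "C11 f"
  by (intro C11_bounded_linear linear_conv_bounded_linear[THEN iffD1] linearI assms)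

lemma C11_add:
  assumes "C11 f" "C11 g" shows "C11 (\<lambda>x. f x + g x)"
proof -
  obtain df dg where "\<And>x. GDERIV f x :> df x" "ball_lipschitz df"
     "\<And>x. GDERIV g x :> dg x" "ball_lipschitz dg"
    using assms unfolding C11_def by blast
  then show ?thesis
    unfolding C11_def
    by (intro exI[of _ "\<lambda>x. df x + dg x"]) (simp add: GDERIV_add ball_lipschitz_add)
qed

lemma C11_mult:
  assumes "C11 f" "C11 g" shows "C11 (\<lambda>x. f x * g x)"
proof -
  obtain df dg where d: "\<And>x. GDERIV f x :> df x" "ball_lipschitz df"
     "\<And>x. GDERIV g x :> dg x" "ball_lipschitz dg"
    using assms unfolding C11_def by blast
  show ?thesis unfolding C11_def
  proof (intro exI conjI allI)
    show "GDERIV (\<lambda>x. f x * g x) x :> f x *\<^sub>R dg x + g x *\<^sub>R df x" for x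
      by (intro GDERIV_mult d)
    show "ball_lipschitz (\<lambda>x. f x *\<^sub>R dg x + g x *\<^sub>R df x)"
      by (intro ball_lipschitz_add ball_lipschitz_scaleR d C11_ball_lipschitz assms)
  qed
qed

lemma C11_diff:
  assumes "C11 f" "C11 g" shows "C11 (\<lambda>x. f x - g x)"
proof -
  have "C11 (\<lambda>x. f x + (-1) * g x)"
    by (intro C11_add C11_mult C11_const assms)
  then show ?thesis by simp
qed

lemma C11_sum: "(\<And>i. i \<in> I \<Longrightarrow> C11 (f i)) \<Longrightarrow> C11 (\<lambda>x. \<Sum>i\<in>I. f i x)"
proof (induction I rule: infinite_finite_induct)
  case (insert i I)
  have "C11 (\<lambda>x. f i x + (\<Sum>i\<in>I. f i x))"
    by (rule C11_add) (use insert in simp_all)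
  then show ?case using insert by simp
next
  case empty show ?case by (simp add: C11_const)
next
  case infinite then show ?case by (simp add: C11_const)
qed

text \<open>Chain rule that asks only for a derivative which is Lipschitz on compact subintervals,
  so that \<open>relu_sq\<close> qualifies.\<close>

lemma C11_compose:
  fixes \<phi> :: "real \<Rightarrow> real"
  assumes "C11 f" and I: "\<And>x. f x \<in> I"
    and \<phi>: "\<And>z. z \<in> I \<Longrightarrow> DERIV \<phi> z :> \<phi>' z"
    and lip: "\<And>a b. {a..b} \<subseteq> I \<Longrightarrow> \<exists>K. K-lipschitz_on {a..b} \<phi>'"
  shows "C11 (\<lambda>x. \<phi> (f x))"
proof -
  obtain df where d: "\<And>x. GDERIV f x :> df x" "ball_lipschitz df"
    using assms(1) unfolding C11_def by blast
  show ?thesis unfolding C11_def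
  proof (intro exI conjI allI)
    show "GDERIV (\<lambda>x. \<phi> (f x)) x :> \<phi>' (f x) *\<^sub>R df x" for x
      by (intro GDERIV_DERIV_compose d \<phi> I)
    show "ball_lipschitz (\<lambda>x. \<phi>' (f x) *\<^sub>R df x)"
      by (intro ball_lipschitz_scaleR d ball_lipschitz_compose[OF C11_ball_lipschitz[OF assms(1)] I lip])
  qed
qed

lemma C11_compose_C2:
  fixes \<phi> :: "real \<Rightarrow> real"
  assumes "C11 f" and "\<And>x. f x \<in> I"
    and "\<And>z. z \<in> I \<Longrightarrow> DERIV \<phi> z :> \<phi>' z"
    and \<phi>'': "\<And>z. z \<in> I \<Longrightarrow> DERIV \<phi>' z :> \<phi>'' z" "continuous_on I \<phi>''"
  shows "C11 (\<lambda>x. \<phi> (f x))"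
proof (rule C11_compose[OF assms(1-3)])
  fix a b assume ab: "{a..b} \<subseteq> I"
  have "bounded (\<phi>'' ` {a..b})"
    using \<phi>''(2) ab by (intro compact_imp_bounded compact_continuous_image) (auto intro: continuous_on_subset)
  then obtain B where B: "\<forall>x\<in>\<phi>'' ` {a..b}. norm x \<le> B"
    unfolding bounded_iff by blast
  \<comment> \<open>The maximum keeps the constant nonnegative when the interval is empty and
    \<open>B\<close> is unconstrained.\<close>
  have "(max 0 B)-lipschitz_on {a..b} \<phi>'"
  proof (rule bounded_derivative_imp_lipschitz)
    fix x assume x: "x \<in> {a..b}"
    show "(\<phi>' has_derivative (*) (\<phi>'' x)) (at x within {a..b})"
      using \<phi>''(1)[OF subsetD[OF ab x]]
      unfolding has_field_derivative_def by (rule has_derivative_at_withinI)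
    show "onorm ((*) (\<phi>'' x)) \<le> max 0 B"
    proof (rule onorm_le)
      fix h
      show "norm (\<phi>'' x * h) \<le> max 0 B * norm h"
        using B x by (auto simp: abs_mult le_max_iff_disj intro!: mult_right_mono)
    qed
  qed auto
  then show "\<exists>K. K-lipschitz_on {a..b} \<phi>'" by blast
qed

section \<open>The scalar functions that occur in the network\<close>

lemma C11_exp: "C11 f \<Longrightarrow> C11 (\<lambda>x. exp (f x))"
  by (rule C11_compose_C2[where I = UNIV and \<phi> = exp and \<phi>' = exp and \<phi>'' = exp])
     (simp_all add: continuous_on_exp)

lemma C11_ln:
  assumes "C11 f" "\<And>x. 0 < f x" shows "C11 (\<lambda>x. ln (f x))"
proof (rule C11_compose_C2[where I = "{0<..}" and \<phi> = ln and \<phi>' = inverse and \<phi>'' = "\<lambda>z. - (inverse z ^ Suc (Suc 0))"])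
  show "continuous_on {0<..} (\<lambda>z::real. - (inverse z ^ Suc (Suc 0)))"
    by (intro continuous_intros) simp
qed (simp_all add: assms DERIV_inverse DERIV_ln del: power_Suc)

lemma C11_inverse:
  assumes "C11 f" "\<And>x. 0 < f x" shows "C11 (\<lambda>x. inverse (f x))"
proof (rule C11_compose_C2[where I = "{0<..}" and \<phi> = inverse and \<phi>' = "\<lambda>z. - (inverse z ^ Suc (Suc 0))"
      and \<phi>'' = "\<lambda>z. 2 * inverse z ^ 3"])
  show "DERIV (\<lambda>z. - (inverse z ^ Suc (Suc 0))) z :> 2 * inverse z ^ 3" if "z \<in> {0<..}" for z :: real
    using that by - (rule derivative_eq_intros refl | simp add: power3_eq_cube)+
  show "continuous_on {0<..} (\<lambda>z::real. 2 * inverse z ^ 3)"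
    by (intro continuous_intros) simp
qed (simp_all add: assms DERIV_inverse del: power_Suc)

lemma C11_sqrt:
  assumes "C11 f" "\<And>x. 0 < f x" shows "C11 (\<lambda>x. sqrt (f x))"
proof (rule C11_compose_C2[where I = "{0<..}" and \<phi> = sqrt and \<phi>' = "\<lambda>z. inverse (sqrt z) / 2"
      and \<phi>'' = "\<lambda>z. - (inverse (sqrt z) ^ 3) / 4"])
  show "DERIV (\<lambda>z. inverse (sqrt z) / 2) z :> - (inverse (sqrt z) ^ 3) / 4" if "z \<in> {0<..}" for z :: real
  proof -
    have "0 < sqrt z" using that by simp
    then have "DERIV (\<lambda>z. inverse (sqrt z)) z :> - (inverse (sqrt z) ^ Suc (Suc 0)) * (inverse (sqrt z) / 2)"
      using DERIV_chain2[OF DERIV_inverse DERIV_real_sqrt, of z] that by simp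
    from DERIV_cdivide[OF this, of 2] show ?thesis
      by (simp add: power3_eq_cube)
  qed
  show "continuous_on {0<..} (\<lambda>z::real. - (inverse (sqrt z) ^ 3) / 4)"
    by (intro continuous_intros) simp_all
qed (simp_all add: assms DERIV_real_sqrt)

lemma C11_tanh: assumes "C11 f" shows "C11 (\<lambda>x. tanh (f x))"
proof (rule C11_compose_C2[where I = UNIV and \<phi> = tanh and \<phi>' = "\<lambda>z. 1 - tanh z ^ 2"
      and \<phi>'' = "\<lambda>z. - (2 * tanh z * (1 - tanh z ^ 2))"])
  show d: "DERIV tanh z :> 1 - tanh z ^ 2" for z :: real
    using has_field_derivative_tanh[OF _ DERIV_ident, of z] by simp
  show "DERIV (\<lambda>z. 1 - tanh z ^ 2) z :> - (2 * tanh z * (1 - tanh z ^ 2))" for z :: real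
    by (rule derivative_eq_intros d refl | simp)+
  show "continuous_on UNIV (\<lambda>z::real. - (2 * tanh z * (1 - tanh z ^ 2)))"
    using d by (intro continuous_on_minus continuous_on_mult continuous_on_diff continuous_on_power
        continuous_on_const continuous_at_imp_continuous_on[of UNIV tanh] ballI DERIV_isCont)
qed (simp_all add: assms)

text \<open>Away from 0 the function agrees locally with the square or with 0; at 0 the difference
  quotient is squeezed by |h|.\<close>

lemma relu_sq_has_derivative: "DERIV relu_sq z :> 2 * max z 0"
proof (cases z "0::real" rule: linorder_cases)
  case greater
  have "DERIV (\<lambda>z. z^2) z :> 2 * max z 0"
    using greater by (auto intro!: derivative_eq_intros)
  then show ?thesis
    by (rule has_field_derivative_transform_within_open[of _ _ _ "{0<..}"]) (use greater in \<open>auto simp: relu_sq_def\<close>)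
next
  case less
  have "DERIV (\<lambda>z. 0) z :> 2 * max z 0"
    using less by (auto intro!: derivative_eq_intros)
  then show ?thesis
    by (rule has_field_derivative_transform_within_open[of _ _ _ "{..<0}"]) (use less in \<open>auto simp: relu_sq_def\<close>)
next
  case equal
  have "\<bar>relu_sq h / h\<bar> \<le> \<bar>h\<bar>" for h
    by (cases "h = 0") (auto simp: relu_sq_def max_def power2_eq_square)
  then have "\<forall>\<^sub>F h in at 0. norm (relu_sq h / h) \<le> \<bar>h\<bar>"
    by (simp only: real_norm_def eventually_True)
  then have "(\<lambda>h. relu_sq h / h) \<midarrow>0\<rightarrow> 0"
    by (rule Lim_null_comparison) (rule tendsto_rabs_zero[OF tendsto_ident_at])
  then show ?thesis
    using equal by (simp add: DERIV_def relu_sq_def)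
qed

lemma C11_relu_sq: "C11 f \<Longrightarrow> C11 (\<lambda>x. relu_sq (f x))"
proof (erule C11_compose[where I = UNIV and \<phi> = relu_sq and \<phi>' = "\<lambda>z. 2 * max z 0"])
  show "DERIV relu_sq z :> 2 * max z 0" for z by (rule relu_sq_has_derivative)
  show "\<exists>K. K-lipschitz_on {a..b} (\<lambda>z. 2 * max z (0::real))" for a b
    by (intro exI[of _ 2] lipschitz_onI) (simp_all add: dist_real_def max_def abs_if)
qed auto

section \<open>Regularity of the potential\<close>

text \<open>Entrywise regularity reduces vector and matrix operations to sums and products of scalar
  \<open>C11\<close> functions.\<close>

definition C11_vec :: "('a::euclidean_space \<Rightarrow> real ^ 'n::finite) \<Rightarrow> bool" where
  "C11_vec F \<longleftrightarrow> (\<forall>i. C11 (\<lambda>x. F x $ i))"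

definition C11_mat :: "('a::euclidean_space \<Rightarrow> real ^ 'n::finite ^ 'm::finite) \<Rightarrow> bool" where
  "C11_mat M \<longleftrightarrow> (\<forall>i j. C11 (\<lambda>x. M x $ i $ j))"

lemma C11_divide:
  assumes "C11 f" "C11 g" "\<And>x. 0 < g x" shows "C11 (\<lambda>x. f x / g x)"
  unfolding divide_inverse by (intro C11_mult C11_inverse assms)

lemma C11_mat_const: "C11_mat (\<lambda>x. c)"
  unfolding C11_mat_def by (simp add: C11_const)

lemma C11_vec_add: "C11_vec F \<Longrightarrow> C11_vec G \<Longrightarrow> C11_vec (\<lambda>x. F x + G x)"
  unfolding C11_vec_def by (simp add: C11_add)

lemma C11_vec_scaleR: "C11 f \<Longrightarrow> C11_vec G \<Longrightarrow> C11_vec (\<lambda>x. f x *\<^sub>R G x)"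
  unfolding C11_vec_def by (simp add: C11_mult)

lemma C11_vec_sum: "(\<And>i. i \<in> I \<Longrightarrow> C11_vec (F i)) \<Longrightarrow> C11_vec (\<lambda>x. \<Sum>i\<in>I. F i x)"
  unfolding C11_vec_def by (simp add: C11_sum)

lemma C11_vec_matrix_mult: "C11_mat M \<Longrightarrow> C11_vec F \<Longrightarrow> C11_vec (\<lambda>x. M x *v F x)"
  unfolding C11_vec_def C11_mat_def matrix_vector_mult_def by (simp add: C11_sum C11_mult)

lemma C11_inner: "C11_vec F \<Longrightarrow> C11_vec G \<Longrightarrow> C11 (\<lambda>x. F x \<bullet> G x)"
  unfolding C11_vec_def inner_vec_def by (simp add: C11_sum C11_mult)

text \<open>Positivity of \<open>\<epsilon>\<close> keeps the radicand away from 0, where the square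
  root is not smooth.\<close>

lemma C11_rms_norm:
  assumes "0 < \<epsilon>" "C11_vec F" shows "C11_vec (\<lambda>x. rms_norm \<epsilon> (F x))"
  unfolding rms_norm_def power2_norm_eq_inner
  using assms(1)
  by (intro C11_vec_scaleR C11_inverse C11_sqrt C11_add C11_divide C11_const C11_inner assms(2))
     (simp_all add: add_nonneg_pos)

lemma C11_head_rows: "C11_mat M \<Longrightarrow> C11_mat (\<lambda>x. head_rows (M x) i)"
  unfolding C11_mat_def head_rows_def by simp

lemma C11_concat_heads: "(\<And>i. C11_vec (F i)) \<Longrightarrow> C11_vec (\<lambda>x. concat_heads (\<lambda>i. F i x))"
  unfolding C11_vec_def concat_heads_def by simp

text \<open>Membership of \<open>i\<close> makes the sum of exponentials nonempty, hence the
  denominator positive.\<close>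

lemma C11_softmax_on:
  assumes "finite I" "i \<in> I" "\<And>j. j \<in> I \<Longrightarrow> C11 (\<lambda>x. z x j)"
  shows "C11 (\<lambda>x. softmax_on I (z x) i)"
  unfolding softmax_on_def
  by (intro C11_divide C11_exp C11_sum sum_pos assms) (use assms in auto)

section \<open>Regularity along the forward map\<close>

lemma C11_qk_vec:
  assumes "0 < \<epsilon>" "C11_mat W" "C11_vec (\<lambda>x. g x t)"
  shows "C11_vec (\<lambda>x. qk_vec \<epsilon> R (W x) (g x) i t)"
  unfolding qk_vec_def
  by (intro C11_vec_matrix_mult C11_mat_const C11_rms_norm C11_head_rows assms)

context
  fixes l :: "'l::{finite,linorder}" and P :: "('l, 'v::finite, 'h::finite, 'k::finite) params \<Rightarrow> ('h, 'k) layer_params"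
  defines "P \<equiv> \<lambda>\<theta>. fst (snd \<theta>) $ l"
begin

text \<open>Each weight matrix is a component of the parameter, so its entries are linear
  functionals.\<close>

lemma C11_layer_params:
  "C11_mat (\<lambda>\<theta>. fst (P \<theta>))" "C11_mat (\<lambda>\<theta>. fst (snd (P \<theta>)))"
  "C11_mat (\<lambda>\<theta>. fst (snd (snd (P \<theta>))))" "C11_mat (\<lambda>\<theta>. fst (snd (snd (snd (P \<theta>)))))"
  "C11_mat (\<lambda>\<theta>. fst (snd (snd (snd (snd (P \<theta>))))))"
  "C11_mat (\<lambda>\<theta>. snd (snd (snd (snd (snd (P \<theta>))))))"
  unfolding C11_mat_def P_def by (intro allI C11_linear; simp)+

lemma C11_attn_score:
  assumes "0 < \<epsilon>" "C11_vec (\<lambda>\<theta>. g \<theta> t)" "C11_vec (\<lambda>\<theta>. g \<theta> s)"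
  shows "C11 (\<lambda>\<theta>. attn_score \<epsilon> c R (P \<theta>) (g \<theta>) i t s)"
  unfolding attn_score_def case_prod_beta
  by (intro C11_mult C11_const C11_inner C11_qk_vec C11_layer_params assms)

lemma C11_attn_out:
  assumes "0 < \<epsilon>" "finite (S t)" "C11_vec (\<lambda>\<theta>. g \<theta> t)" "\<And>s. s \<in> S t \<Longrightarrow> C11_vec (\<lambda>\<theta>. g \<theta> s)"
  shows "C11_vec (\<lambda>\<theta>. attn_out \<epsilon> c R S (P \<theta>) (g \<theta>) t)"
  unfolding attn_out_def case_prod_beta
  by (intro C11_vec_matrix_mult C11_concat_heads C11_vec_sum C11_vec_scaleR C11_softmax_on
      C11_attn_score C11_head_rows C11_layer_params assms)

lemma C11_mlp_out:
  assumes "C11_vec b" shows "C11_vec (\<lambda>\<theta>. mlp_out (P \<theta>) (b \<theta>))"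
proof -
  have "C11_vec (\<lambda>\<theta>. fst (snd (snd (snd (snd (P \<theta>))))) *v b \<theta>)"
    by (intro C11_vec_matrix_mult C11_layer_params assms)
  then have "C11_vec (\<lambda>\<theta>. \<chi> r. relu_sq ((fst (snd (snd (snd (snd (P \<theta>))))) *v b \<theta>) $ r))"
    unfolding C11_vec_def by (simp add: C11_relu_sq)
  then show ?thesis
    unfolding mlp_out_def case_prod_beta by (intro C11_vec_matrix_mult C11_layer_params)
qed

lemma C11_layer_step:
  assumes "0 < \<epsilon>" "finite (S t)" "C11_vec (\<lambda>\<theta>. f \<theta> t)" "\<And>s. s \<in> S t \<Longrightarrow> C11_vec (\<lambda>\<theta>. f \<theta> s)"
  shows "C11_vec (\<lambda>\<theta>. layer_step \<epsilon> c R S (P \<theta>) (f \<theta>) t)"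
  unfolding layer_step_def Let_def attn_step_def
  by (intro C11_vec_add C11_mlp_out C11_rms_norm C11_attn_out assms)

end

text \<open>The windows are causal: position \<open>t\<close> looks only at positions up to
  \<open>t\<close>, so the restriction \<open>t < T\<close> passes through the induction over the
  layers. Containment in \<open>{0..t}\<close> also makes the windows finite.\<close>

lemma C11_hidden:
  fixes S :: "'l::{finite,linorder} \<Rightarrow> nat \<Rightarrow> nat set"
  assumes "0 < \<epsilon>" and S: "\<And>l t. t < T \<Longrightarrow> S l t \<subseteq> {0..t}" and "t < T"
  shows "C11_vec (\<lambda>\<theta> :: ('l, 'v::finite, 'h::finite, 'k::finite) params. hidden \<epsilon> c R S \<theta> x n t)"
  using assms(3)
proof (induction n arbitrary: t)
  case 0
  show ?case unfolding C11_vec_def hidden.simps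
    by (intro allI C11_linear) simp_all
next
  case (Suc n)
  have sub: "S (nth_layer n) t \<subseteq> {0..t}" using S Suc.prems by blast
  show ?case unfolding hidden.simps
  proof (rule C11_layer_step)
    show "finite (S (nth_layer n) t)" using sub finite_subset by blast
    show "C11_vec (\<lambda>\<theta> :: ('l, 'v, 'h, 'k) params. hidden \<epsilon> c R S \<theta> x n s)" if "s \<in> S (nth_layer n) t" for s
      using sub that Suc.prems by (intro Suc.IH) fastforce
  qed (use assms Suc in auto)
qed

lemma C11_capped_logit:
  fixes S :: "'l::{finite,linorder} \<Rightarrow> nat \<Rightarrow> nat set"
  assumes "0 < \<epsilon>" "\<And>l t. t < T \<Longrightarrow> S l t \<subseteq> {0..t}" "t < T"
  shows "C11 (\<lambda>\<theta> :: ('l, 'v::finite, 'h::finite, 'k::finite) params. capped_logit \<epsilon> \<tau> c R S \<theta> x t j)"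
proof -
  have "C11_mat (\<lambda>\<theta> :: ('l, 'v, 'h, 'k) params. snd (snd \<theta>))"
    unfolding C11_mat_def by (intro allI C11_linear) simp_all
  then have "C11_vec (\<lambda>\<theta> :: ('l, 'v, 'h, 'k) params.
      snd (snd \<theta>) *v rms_norm \<epsilon> (hidden \<epsilon> c R S \<theta> x CARD('l) t))"
    by (intro C11_vec_matrix_mult C11_rms_norm C11_hidden[where T = T] assms)
  then show ?thesis
    unfolding capped_logit_def softcap_def C11_vec_def divide_inverse
    by (intro C11_mult C11_const C11_tanh) blast
qed

lemma C11_sequence_loss:
  fixes S :: "'l::{finite,linorder} \<Rightarrow> nat \<Rightarrow> nat set"
  assumes "0 < \<epsilon>" "\<And>l t. t < T \<Longrightarrow> S l t \<subseteq> {0..t}"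
  shows "C11 (\<lambda>\<theta> :: ('l, 'v::finite, 'h::finite, 'k::finite) params. sequence_loss \<epsilon> \<tau> c R S T \<theta> x)"
  unfolding sequence_loss_def
proof (intro C11_mult C11_const C11_sum C11_diff)
  fix t assume t: "t \<in> {..<T}"
  show "C11 (\<lambda>\<theta> :: ('l, 'v, 'h, 'k) params. ln (\<Sum>j\<in>UNIV. exp (capped_logit \<epsilon> \<tau> c R S \<theta> x t j)))"
    using t by (intro C11_ln C11_sum C11_exp C11_capped_logit[where T = T] sum_pos assms) auto
  show "C11 (\<lambda>\<theta> :: ('l, 'v, 'h, 'k) params. capped_logit \<epsilon> \<tau> c R S \<theta> x t (x ! (t + 1)))"
    using t by (intro C11_capped_logit[where T = T] assms) auto
qed

text \<open>There are finitely many token sequences of length \<open>T + 1\<close>, so the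
  expectation is a finite weighted sum and inherits the regularity of its terms.\<close>

lemma C11_potential:
  fixes S :: "'l::{finite,linorder} \<Rightarrow> nat \<Rightarrow> nat set" and D :: "'v::finite list pmf"
  assumes "0 < \<epsilon>" "\<And>l t. t < T \<Longrightarrow> S l t \<subseteq> {0..t}" and D: "set_pmf D \<subseteq> {x. length x = T + 1}"
  shows "C11 (potential \<epsilon> \<tau> c R S T D :: ('l, 'v, 'h::finite, 'k::finite) params \<Rightarrow> real)"
proof -
  let ?X = "{x :: 'v list. set x \<subseteq> UNIV \<and> length x = T + 1}"
  have "finite ?X" by (rule finite_lists_length_eq) simp
  then have "potential \<epsilon> \<tau> c R S T D =
      (\<lambda>\<theta> :: ('l, 'v, 'h, 'k) params. \<Sum>x\<in>?X. sequence_loss \<epsilon> \<tau> c R S T \<theta> x * pmf D x)"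
    unfolding potential_def using D by (intro ext integral_measure_pmf_real) auto
  moreover have "C11 (\<lambda>\<theta> :: ('l, 'v, 'h, 'k) params. \<Sum>x\<in>?X. sequence_loss \<epsilon> \<tau> c R S T \<theta> x * pmf D x)"
    by (intro C11_sum C11_mult C11_const C11_sequence_loss assms)
  ultimately show ?thesis by simp
qed

section \<open>Monotonicity of gradients from almost everywhere Hessian bounds\<close>

text \<open>Subtract a line of slope slightly below \<open>m\<close>. A Lipschitz function maps the null set \<open>N\<close> to a null
  set, so if the resulting function decreased, it would take some intermediate value only outside
  of \<open>N\<close>; at the last point where this value is taken, the positive derivative is contradicted.\<close>

lemma lipschitz_increment_ge:
  fixes \<phi> :: "real \<Rightarrow> real"
  assumes "a \<le> b" and lip: "K-lipschitz_on {a..b} \<phi>" and "negligible N"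
    and deriv: "\<And>s. a < s \<Longrightarrow> s < b \<Longrightarrow> s \<notin> N \<Longrightarrow> \<exists>D\<ge>m. DERIV \<phi> s :> D"
  shows "m * (b - a) \<le> \<phi> b - \<phi> a"
proof (rule ccontr)
  assume *: "\<not> m * (b - a) \<le> \<phi> b - \<phi> a"
  with \<open>a \<le> b\<close> have "a < b" by (cases "a = b") auto
  with * have "(\<phi> b - \<phi> a) / (b - a) < m" by (simp add: field_simps)
  then obtain m' where m': "(\<phi> b - \<phi> a) / (b - a) < m'" "m' < m" using dense by blast
  define \<psi> where "\<psi> s = \<phi> s - m' * s" for s
  have "\<phi> b - \<phi> a < m' * (b - a)" using m'(1) \<open>a < b\<close> by (simp add: field_simps)
  then have ba: "\<psi> b < \<psi> a" by (simp add: \<psi>_def algebra_simps)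
  have "(K + \<bar>m'\<bar> * 1)-lipschitz_on {a..b} \<psi>"
    unfolding \<psi>_def by (intro lipschitz_on_diff lip lipschitz_on_cmult_real lipschitz_on_id)
  then obtain M where M: "M-lipschitz_on {a..b} \<psi>" by blast
  then have cont: "continuous_on {a..b} \<psi>" by (rule lipschitz_on_continuous_on)
  have "negligible (\<psi> ` (N \<inter> {a..b}))"
  proof (rule negligible_locally_Lipschitz_image)
    show "negligible (N \<inter> {a..b})" using \<open>negligible N\<close> by (simp add: negligible_Int)
    fix x assume x: "x \<in> N \<inter> {a..b}"
    show "\<exists>T B. open T \<and> x \<in> T \<and> (\<forall>y\<in>N \<inter> {a..b} \<inter> T. norm (\<psi> y - \<psi> x) \<le> B * norm (y - x))"
      using x lipschitz_onD[OF M] by (intro exI[of _ UNIV] exI[of _ M]) (auto simp: dist_norm)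
  qed simp
  moreover have "\<not> negligible {\<psi> b<..<\<psi> a}"
    using ba by (intro open_not_negligible) auto
  ultimately have "\<not> {\<psi> b<..<\<psi> a} \<subseteq> \<psi> ` (N \<inter> {a..b})"
    using negligible_subset by metis
  then obtain c where "c \<in> {\<psi> b<..<\<psi> a}" and cN: "c \<notin> \<psi> ` (N \<inter> {a..b})" by blast
  then have c: "\<psi> b < c" "c < \<psi> a" by auto
  define X where "X = {s \<in> {a..b}. \<psi> s = c}"
  have "\<exists>s\<ge>a. s \<le> b \<and> \<psi> s = c"
    using c \<open>a \<le> b\<close> cont by (intro IVT2') auto
  then have "X \<noteq> {}" by (auto simp: X_def)
  moreover have "compact X"
    unfolding compact_eq_bounded_closed X_def
    using continuous_closed_preimage_constant[OF cont]
    by (auto intro: bounded_subset[of "{a..b}"])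
  ultimately obtain s where s: "s \<in> X" "\<And>t. t \<in> X \<Longrightarrow> t \<le> s"
    using compact_attains_sup by metis
  have "s \<noteq> a" "s \<noteq> b" "s \<notin> N" "\<psi> s = c" "a \<le> s" "s \<le> b"
    using s(1) c cN by (auto simp: X_def)
  then obtain D where D: "m \<le> D" "DERIV \<phi> s :> D"
    using deriv[of s] by force
  have "DERIV \<psi> s :> D - m'"
    unfolding \<psi>_def using DERIV_diff[OF D(2) DERIV_cmult_Id[of m']] by simp
  moreover have "0 < D - m'" using D m' by simp
  ultimately obtain d where d: "0 < d" "\<And>h. 0 < h \<Longrightarrow> h < d \<Longrightarrow> \<psi> s < \<psi> (s + h)"
    using DERIV_pos_inc_right by metis
  \<comment> \<open>This point lies in the interval and in the range where the positive derivative
    forces growth. From a value above \<open>c\<close> at \<open>t\<close> and one below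
    \<open>c\<close> at \<open>b\<close>, the intermediate value theorem gives a crossing later than
    \<open>s\<close>.\<close>
  define t where "t = s + min (d / 2) (b - s)"
  have t: "s < t" "t \<le> b" "c < \<psi> t"
    using d(1) d(2)[of "min (d / 2) (b - s)"] \<open>s \<noteq> b\<close> \<open>s \<le> b\<close> \<open>\<psi> s = c\<close> by (auto simp: t_def)
  have "\<exists>r\<ge>t. r \<le> b \<and> \<psi> r = c"
    using c t \<open>a \<le> s\<close> by (intro IVT2' continuous_on_subset[OF cont]) auto
  then obtain r where "t \<le> r" "r \<le> b" "\<psi> r = c" by blast
  then show False
    using s(2)[of r] t \<open>a \<le> s\<close> by (auto simp: X_def)
qed

text \<open>A property that holds almost everywhere may fail on one given line, but not on almost
  every parallel line. For each fixed \<open>s\<close> a translate of a null set is null, and Fubini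
  exchanges the two quantifiers.\<close>

lemma AE_along_lines:
  fixes d :: "'a::euclidean_space"
  assumes "AE y in lborel. Q y"
  shows "AE y in lborel. AE s in lborel. Q (y + s *\<^sub>R d)"
proof -
  \<comment> \<open>A Borel null set around the exceptional set provides the joint measurability
    that Fubini requires.\<close>
  obtain N where N: "N \<in> null_sets lborel" "{y. \<not> Q y} \<subseteq> N"
    using assms unfolding eventually_ae_filter by auto
  then have [measurable]: "N \<in> sets borel" by auto
  have "AE y in lborel. y + s *\<^sub>R d \<notin> N" for s :: real
  proof -
    have "AE y in distr lborel borel ((+) (s *\<^sub>R d)). y \<notin> N"
      unfolding lborel_distr_plus using N(1) by (rule AE_not_in)
    then show ?thesis by (subst (asm) AE_distr_iff) (auto simp: add.commute)
  qed
  then have "AE s in lborel. AE y in lborel. y + s *\<^sub>R d \<notin> N" by simp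
  moreover have "{x \<in> space (lborel \<Otimes>\<^sub>M (lborel :: real measure)). fst x + snd x *\<^sub>R d \<notin> N}
      \<in> sets (lborel \<Otimes>\<^sub>M lborel)"
    by measurable
  ultimately have "AE y in lborel. AE s in lborel. y + s *\<^sub>R d \<notin> N"
    using lborel_pair.AE_commute[of "\<lambda>y s. y + s *\<^sub>R d \<notin> N"] by blast
  then show ?thesis
    by eventually_elim (erule eventually_mono, use N(2) in blast)
qed

text \<open>The set where the inequality fails is open and null, hence empty.\<close>

lemma AE_continuous_le:
  fixes f g :: "'a::euclidean_space \<Rightarrow> real"
  assumes "AE y in lborel. f y \<le> g y" "continuous_on UNIV f" "continuous_on UNIV g"
  shows "f y \<le> g y"
proof -
  obtain N where N: "N \<in> null_sets lborel" "{y. \<not> f y \<le> g y} \<subseteq> N"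
    using assms(1) unfolding eventually_ae_filter by auto
  have "negligible {y. g y < f y}"
    using N null_sets_completionI negligible_iff_null_sets negligible_subset
    by (metis (mono_tags, lifting) linorder_not_le mem_Collect_eq subset_iff)
  moreover have "open {y. g y < f y}"
    by (intro open_Collect_less assms)
  ultimately have "{y. g y < f y} = {}" using open_not_negligible by blast
  then show ?thesis by (auto simp: not_less)
qed

text \<open>The part of \<open>hessian_ge\<close> that is integrated along lines, stated for one
  fixed gradient map instead of some gradient near the point.\<close>

definition derivative_ge :: "('a::euclidean_space \<Rightarrow> 'a) \<Rightarrow> real \<Rightarrow> 'a \<Rightarrow> bool" where
  "derivative_ge G c y \<longleftrightarrow> (\<exists>A. (G has_derivative A) (at y) \<and> (\<forall>v. c * (norm v)\<^sup>2 \<le> v \<bullet> A v))"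

text \<open>Where the bound holds, the map sending s to
  \<open>G (y + s *\<^sub>R d) \<bullet> d\<close> has derivative \<open>d \<bullet> A d\<close>,
  and \<open>lipschitz_increment_ge\<close> integrates it. Asking for \<open>m\<close> only on the
  open interval lets a segment be cut where the modulus \<open>c\<close> jumps.\<close>

lemma line_increment_ge:
  assumes "ball_lipschitz G" and "a \<le> b"
    and ae: "AE s in lborel. derivative_ge G (c (y + s *\<^sub>R d)) (y + s *\<^sub>R d)"
    and m: "\<And>s. a < s \<Longrightarrow> s < b \<Longrightarrow> m \<le> c (y + s *\<^sub>R d)"
  shows "m * (b - a) * (norm d)\<^sup>2 \<le> (G (y + b *\<^sub>R d) - G (y + a *\<^sub>R d)) \<bullet> d"
proof -
  define \<phi> where "\<phi> s = G (y + s *\<^sub>R d) \<bullet> d" for s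
  define r where "r = norm y + max \<bar>a\<bar> \<bar>b\<bar> * norm d"
  obtain K where K: "K-lipschitz_on (cball 0 r) G"
    using assms(1) unfolding ball_lipschitz_def by blast
  have r: "y + s *\<^sub>R d \<in> cball 0 r" if "s \<in> {a..b}" for s
  proof -
    have "norm (y + s *\<^sub>R d) \<le> norm y + \<bar>s\<bar> * norm d"
      using norm_triangle_ineq[of y "s *\<^sub>R d"] by simp
    also have "\<dots> \<le> r" unfolding r_def using that
      by (intro add_left_mono mult_right_mono) auto
    finally show ?thesis by simp
  qed
  have lip: "(K * (norm d)\<^sup>2)-lipschitz_on {a..b} \<phi>"
  proof (rule lipschitz_onI)
    fix s t assume st: "s \<in> {a..b}" "t \<in> {a..b}"
    have "dist (\<phi> s) (\<phi> t) = \<bar>(G (y + s *\<^sub>R d) - G (y + t *\<^sub>R d)) \<bullet> d\<bar>"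
      by (simp add: \<phi>_def dist_real_def inner_diff_left)
    also have "\<dots> \<le> dist (G (y + s *\<^sub>R d)) (G (y + t *\<^sub>R d)) * norm d"
      unfolding dist_norm by (rule Cauchy_Schwarz_ineq2)
    also have "\<dots> \<le> K * dist (y + s *\<^sub>R d) (y + t *\<^sub>R d) * norm d"
      by (intro mult_right_mono lipschitz_onD[OF K] r st) simp
    also have "dist (y + s *\<^sub>R d) (y + t *\<^sub>R d) = dist s t * norm d"
      by (simp add: dist_norm scaleR_diff_left[symmetric])
    finally show "dist (\<phi> s) (\<phi> t) \<le> K * (norm d)\<^sup>2 * dist s t"
      by (simp add: power2_eq_square mult_ac)
  qed (use lipschitz_on_nonneg[OF K] in simp)
  obtain N where N: "N \<in> null_sets lborel" "{s. \<not> derivative_ge G (c (y + s *\<^sub>R d)) (y + s *\<^sub>R d)} \<subseteq> N"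
    using ae unfolding eventually_ae_filter by auto
  have "negligible N"
    using N(1) null_sets_completionI negligible_iff_null_sets by blast
  have "m * (norm d)\<^sup>2 * (b - a) \<le> \<phi> b - \<phi> a"
  proof (rule lipschitz_increment_ge[OF \<open>a \<le> b\<close> lip \<open>negligible N\<close>])
    fix s assume s: "a < s" "s < b" "s \<notin> N"
    then have "derivative_ge G (c (y + s *\<^sub>R d)) (y + s *\<^sub>R d)" using N(2) by blast
    then obtain A where A: "(G has_derivative A) (at (y + s *\<^sub>R d))"
        "\<And>v. c (y + s *\<^sub>R d) * (norm v)\<^sup>2 \<le> v \<bullet> A v"
      unfolding derivative_ge_def by blast
    have "((\<lambda>s. y + s *\<^sub>R d) has_derivative (\<lambda>h. h *\<^sub>R d)) (at s)"
      by (auto intro!: derivative_eq_intros)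
    from has_derivative_inner_left[OF has_derivative_compose[OF this A(1)], of d]
    have "(\<phi> has_derivative (\<lambda>h. A (h *\<^sub>R d) \<bullet> d)) (at s)"
      by (simp add: \<phi>_def[abs_def])
    moreover have "A (h *\<^sub>R d) \<bullet> d = (d \<bullet> A d) * h" for h
      using has_derivative_linear[OF A(1)] by (simp add: linear_cmul inner_commute)
    ultimately have "DERIV \<phi> s :> d \<bullet> A d"
      unfolding has_field_derivative_def by simp
    moreover have "m * (norm d)\<^sup>2 \<le> d \<bullet> A d"
      using A(2)[of d] mult_right_mono[OF m[OF s(1,2)], of "(norm d)\<^sup>2"] by simp
    ultimately show "\<exists>D\<ge>m * (norm d)\<^sup>2. DERIV \<phi> s :> D" by blast
  qed
  then show ?thesis by (simp add: \<phi>_def inner_diff_left mult_ac)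
qed

lemma continuous_on_line_increment:
  assumes "ball_lipschitz G"
  shows "continuous_on UNIV (\<lambda>y. (G (y + d) - G y) \<bullet> d)"
  by (intro continuous_intros continuous_on_compose2[OF ball_lipschitz_continuous_on[OF assms, of UNIV]]) auto

text \<open>The direction stays fixed while the base point moves: the bound holds for almost every
  base point, and continuity yields it at \<open>y\<close>.\<close>

lemma gradient_increment_ge:
  assumes "ball_lipschitz G" and ae: "AE y in lborel. derivative_ge G m y"
  shows "m * (norm (x - y))\<^sup>2 \<le> (G x - G y) \<bullet> (x - y)"
proof -
  let ?d = "x - y"
  have "AE y in lborel. m * (norm ?d)\<^sup>2 \<le> (G (y + ?d) - G y) \<bullet> ?d"
    using AE_along_lines[OF ae, of ?d]
  proof eventually_elim
    case (elim y)
    then show ?case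
      using line_increment_ge[OF assms(1), where a = 0 and b = 1 and c = "\<lambda>_. m" and m = m and y = y and d = ?d] by simp
  qed
  from AE_continuous_le[OF this continuous_on_const continuous_on_line_increment[OF assms(1)], of y]
  show ?thesis by simp
qed

text \<open>A segment meets the ball of radius \<open>\<rho>\<close> in a piece of length at most \<open>2 \<rho>\<close>, which is the only
  place where the convexity modulus may drop from \<open>\<mu>\<close> to \<open>- L\<close>.\<close>

lemma gradient_increment_ge_outside_ball:
  assumes "ball_lipschitz G" and "0 \<le> \<rho>" "0 \<le> \<mu> + L"
    and ae: "AE y in lborel. derivative_ge G (if \<rho> \<le> norm y then \<mu> else - L) y"
  shows "\<mu> * (norm (x - y))\<^sup>2 - 2 * \<rho> * (\<mu> + L) * norm (x - y) \<le> (G x - G y) \<bullet> (x - y)"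
proof -
  let ?d = "x - y" and ?c = "\<lambda>y. if \<rho> \<le> norm y then \<mu> else - L"
  have "AE y in lborel. \<mu> * (norm ?d)\<^sup>2 - 2 * \<rho> * (\<mu> + L) * norm ?d \<le> (G (y + ?d) - G y) \<bullet> ?d"
    using AE_along_lines[OF ae, of ?d]
  proof eventually_elim
    case (elim y)
    have incr: "m * (b - a) * (norm ?d)\<^sup>2 \<le> (G (y + b *\<^sub>R ?d) - G (y + a *\<^sub>R ?d)) \<bullet> ?d"
      if "a \<le> b" "\<And>s. a < s \<Longrightarrow> s < b \<Longrightarrow> m \<le> ?c (y + s *\<^sub>R ?d)" for a b m
      using line_increment_ge[OF assms(1), where c = ?c, OF that(1) elim that(2)] .
    define X where "X = {s \<in> {0..1}. norm (y + s *\<^sub>R ?d) \<le> \<rho>}"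
    \<comment> \<open>Written as a preimage of a ball under a linear map, cut with the unit
      interval, \<open>X\<close> is visibly convex and compact, hence a possibly empty
      interval.\<close>
    have X: "X = {0..1} \<inter> (\<lambda>s. s *\<^sub>R ?d) -` cball (- y) \<rho>"
      by (auto simp: X_def dist_norm norm_minus_commute algebra_simps)
    have "compact X"
      unfolding X by (intro compact_Int_closed closed_vimage continuous_intros) auto
    moreover have "convex X"
      unfolding X by (intro convex_Int convex_linear_vimage linear_scaleR_left) auto
    ultimately obtain a b where ab: "X = {a..b}"
      using connected_compact_interval_1 convex_connected by blast
    have nX: "\<rho> \<le> norm (y + s *\<^sub>R ?d)" if "s \<in> {0..1}" "s \<notin> X" for s
      using that by (simp add: X_def)
    show ?case
    proof (cases "a \<le> b")
      case False
      then have "\<mu> * (norm ?d)\<^sup>2 \<le> (G (y + ?d) - G y) \<bullet> ?d"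
        using incr[of 0 1 \<mu>] nX ab by simp
      moreover have "0 \<le> 2 * \<rho> * (\<mu> + L) * norm ?d" using assms by simp
      ultimately show ?thesis by linarith
    next
      case True
      then have "a \<in> X" "b \<in> X" by (auto simp: ab)
      then have in01: "0 \<le> a" "b \<le> 1" and ball: "norm (y + a *\<^sub>R ?d) \<le> \<rho>" "norm (y + b *\<^sub>R ?d) \<le> \<rho>"
        by (auto simp: X_def)
      \<comment> \<open>The chord inside the ball is at most a diameter long; the factor
        \<open>\<mu> + L\<close> is the loss in modulus there.\<close>
      have "(b - a) * norm ?d = norm ((y + b *\<^sub>R ?d) - (y + a *\<^sub>R ?d))"
        using True by (simp add: scaleR_diff_left[symmetric])
      also have "\<dots> \<le> 2 * \<rho>"
        using norm_triangle_ineq4[of "y + b *\<^sub>R ?d" "y + a *\<^sub>R ?d"] ball by linarith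
      finally have "(b - a) * norm ?d * ((\<mu> + L) * norm ?d) \<le> 2 * \<rho> * ((\<mu> + L) * norm ?d)"
        using assms by (intro mult_right_mono) auto
      \<comment> \<open>The increments over the three pieces telescope. On the middle one
        \<open>- L\<close> is a lower bound even at boundary points with modulus
        \<open>\<mu>\<close>, because \<open>\<mu> + L\<close> is nonnegative.\<close>
      moreover have "\<mu> * (a - 0) * (norm ?d)\<^sup>2 \<le> (G (y + a *\<^sub>R ?d) - G (y + 0 *\<^sub>R ?d)) \<bullet> ?d"
        using in01 True nX ab by (intro incr) auto
      moreover have "- L * (b - a) * (norm ?d)\<^sup>2 \<le> (G (y + b *\<^sub>R ?d) - G (y + a *\<^sub>R ?d)) \<bullet> ?d"
        using True assms by (intro incr) auto
      moreover have "\<mu> * (1 - b) * (norm ?d)\<^sup>2 \<le> (G (y + 1 *\<^sub>R ?d) - G (y + b *\<^sub>R ?d)) \<bullet> ?d"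
        using in01 True nX ab by (intro incr) auto
      ultimately show ?thesis
        by (simp add: inner_diff_left power2_eq_square algebra_simps)
    qed
  qed
  from AE_continuous_le[OF this continuous_on_const continuous_on_line_increment[OF assms(1)], of y]
  show ?thesis by simp
qed

section \<open>Hessian bounds\<close>

lemma hessian_ge_mono:
  assumes "hessian_ge f x c" "c' \<le> c" shows "hessian_ge f x c'"
proof -
  obtain A where A: "has_hessian f A x" "linear (\<lambda>v. A v - c *\<^sub>R v)"
      "\<And>v w. (A v - c *\<^sub>R v) \<bullet> w = v \<bullet> (A w - c *\<^sub>R w)" "\<And>v. 0 \<le> v \<bullet> (A v - c *\<^sub>R v)"
    using assms(1) unfolding hessian_ge_def loewner_ge_def psd_def by blast
  have split: "A v - c' *\<^sub>R v = (A v - c *\<^sub>R v) + (c - c') *\<^sub>R v" for v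
    by (simp add: algebra_simps)
  have "linear (\<lambda>v. A v - c' *\<^sub>R v)"
    unfolding split by (intro linear_compose_add A(2) linear_scale_self)
  moreover have "(A v - c' *\<^sub>R v) \<bullet> w = v \<bullet> (A w - c' *\<^sub>R w)" for v w
    using A(3)[of v w] unfolding split by (simp add: inner_add_left inner_add_right)
  moreover have "0 \<le> v \<bullet> (A v - c' *\<^sub>R v)" for v
    using A(4)[of v] assms(2) unfolding split inner_add_right by simp
  ultimately show ?thesis
    using A(1) unfolding hessian_ge_def loewner_ge_def psd_def by blast
qed

lemma hessian_ge_add:
  assumes "hessian_ge f x c" "hessian_ge g x d"
  shows "hessian_ge (\<lambda>x. f x + g x) x (c + d)"
proof -
  obtain A where A: "has_hessian f A x" "linear (\<lambda>v. A v - c *\<^sub>R v)"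
      "\<And>v w. (A v - c *\<^sub>R v) \<bullet> w = v \<bullet> (A w - c *\<^sub>R w)" "\<And>v. 0 \<le> v \<bullet> (A v - c *\<^sub>R v)"
    using assms(1) unfolding hessian_ge_def loewner_ge_def psd_def by blast
  obtain B where B: "has_hessian g B x" "linear (\<lambda>v. B v - d *\<^sub>R v)"
      "\<And>v w. (B v - d *\<^sub>R v) \<bullet> w = v \<bullet> (B w - d *\<^sub>R w)" "\<And>v. 0 \<le> v \<bullet> (B v - d *\<^sub>R v)"
    using assms(2) unfolding hessian_ge_def loewner_ge_def psd_def by blast
  have split: "A v + B v - (c + d) *\<^sub>R v = (A v - c *\<^sub>R v) + (B v - d *\<^sub>R v)" for v
    by (simp add: algebra_simps)
  obtain df dg where df: "\<forall>\<^sub>F y in nhds x. GDERIV f y :> df y" "(df has_derivative A) (at x)"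
    and dg: "\<forall>\<^sub>F y in nhds x. GDERIV g y :> dg y" "(dg has_derivative B) (at x)"
    using A(1) B(1) unfolding has_hessian_def by blast
  have "\<forall>\<^sub>F y in nhds x. GDERIV (\<lambda>x. f x + g x) y :> df y + dg y"
    using df(1) dg(1) by eventually_elim (rule GDERIV_add)
  with has_derivative_add[OF df(2) dg(2)]
  have "has_hessian (\<lambda>x. f x + g x) (\<lambda>v. A v + B v) x"
    unfolding has_hessian_def by (intro exI[of _ "\<lambda>y. df y + dg y"]) simp
  moreover have "linear (\<lambda>v. A v + B v - (c + d) *\<^sub>R v)"
    unfolding split by (intro linear_compose_add A(2) B(2))
  moreover have "(A v + B v - (c + d) *\<^sub>R v) \<bullet> w = v \<bullet> (A w + B w - (c + d) *\<^sub>R w)" for v w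
    using A(3)[of v w] B(3)[of v w] unfolding split by (simp add: inner_add_left inner_add_right)
  moreover have "0 \<le> v \<bullet> (A v + B v - (c + d) *\<^sub>R v)" for v
    using A(4)[of v] B(4)[of v] unfolding split inner_add_right[of v "A v - c *\<^sub>R v"] by simp
  ultimately show ?thesis
    unfolding hessian_ge_def loewner_ge_def psd_def by blast
qed

text \<open>The gradient hidden in \<open>has_hessian\<close> agrees with \<open>G\<close> near the
  point by uniqueness, so its derivative transfers to \<open>G\<close>.\<close>

lemma hessian_ge_imp_derivative_ge:
  assumes "hessian_ge f x c" and G: "\<And>y. GDERIV f y :> G y"
  shows "derivative_ge G c x"
proof -
  obtain A where A: "has_hessian f A x" "\<And>v. 0 \<le> v \<bullet> (A v - c *\<^sub>R v)"
    using assms(1) unfolding hessian_ge_def loewner_ge_def psd_def by blast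
  then obtain g where g: "\<forall>\<^sub>F y in nhds x. GDERIV f y :> g y" "(g has_derivative A) (at x)"
    unfolding has_hessian_def by blast
  have eq: "g y = G y" if "GDERIV f y :> g y" for y
    using has_derivative_unique[OF that[unfolded gderiv_def] G[of y, unfolded gderiv_def]]
    by (metis vector_eq_ldot)
  have "\<forall>\<^sub>F y in nhds x. g y = G y"
    using g(1) by eventually_elim (rule eq)
  then obtain U where U: "open U" "x \<in> U" "\<And>y. y \<in> U \<Longrightarrow> g y = G y"
    unfolding eventually_nhds by blast
  have "(G has_derivative A) (at x)"
    by (rule has_derivative_transform_within_open[OF g(2) U])
  moreover have "c * (norm v)\<^sup>2 \<le> v \<bullet> A v" for v
    using A(2)[of v] by (simp add: inner_diff_right power2_norm_eq_inner)
  ultimately show ?thesis unfolding derivative_ge_def by blast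
qed

text \<open>With the exponent written as \<open>q + 2\<close>, the gradient formula involves no
  division and holds at the origin too, where the norm itself is not differentiable.\<close>

lemma GDERIV_norm_power:
  "GDERIV (\<lambda>x :: 'a::euclidean_space. norm x ^ (q + 2)) x :> (real (q + 2) * norm x ^ q) *\<^sub>R x"
proof (cases "x = 0")
  case True
  have "(\<lambda>h :: 'a. norm h ^ Suc q) \<midarrow>0\<rightarrow> norm (0 :: 'a) ^ Suc q"
    by (intro tendsto_intros)
  moreover have "norm h ^ (q + 2) / norm h = norm h ^ Suc q" for h :: 'a
    by (cases "h = 0") simp_all
  ultimately show ?thesis
    using True by (simp add: gderiv_def has_derivative_at)
next
  case False
  have "DERIV (\<lambda>t. t ^ (q + 2)) (norm x) :> real (q + 2) * norm x ^ Suc q"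
    using DERIV_pow[of "q + 2" "norm x"] by simp
  from GDERIV_DERIV_compose[OF GDERIV_norm[OF False] this]
  have "GDERIV (\<lambda>x. norm x ^ (q + 2)) x :> (real (q + 2) * norm x ^ Suc q) *\<^sub>R sgn x" .
  moreover have "(real (q + 2) * norm x ^ Suc q) *\<^sub>R sgn x = (real (q + 2) * norm x ^ q) *\<^sub>R x"
    using False unfolding sgn_div_norm scaleR_scaleR by (intro arg_cong2[of _ _ x x scaleR]) simp_all
  ultimately show ?thesis by metis
qed

lemma GDERIV_cmult_norm_power:
  "GDERIV (\<lambda>x :: 'a::euclidean_space. c * norm x ^ (q + 2)) x :> (c * real (q + 2) * norm x ^ q) *\<^sub>R x"
  using GDERIV_mult[OF GDERIV_const[of c] GDERIV_norm_power[of q x]] by (simp add: mult.assoc)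

lemma ball_lipschitz_norm_power_gradient: "ball_lipschitz (\<lambda>x. (c * norm x ^ q) *\<^sub>R x)"
proof -
  have "ball_lipschitz (\<lambda>x. c *\<^sub>R norm x ^ q)"
    by (intro ball_lipschitz_scaleR ball_lipschitz_const ball_lipschitz_power ball_lipschitz_norm)
  from ball_lipschitz_scaleR[OF this ball_lipschitz_id] show ?thesis by simp
qed

text \<open>The Hessian of \<open>c |x|^(q + 2)\<close> is \<open>c (q + 2) (|x|^q I + q |x|^(q - 2) x x\<^sup>T)\<close>, whose
  rank-one part is dropped.\<close>

lemma hessian_ge_norm_power:
  fixes x :: "'a::euclidean_space"
  assumes "x \<noteq> 0" "0 \<le> c"
  shows "hessian_ge (\<lambda>x. c * norm x ^ (q + 2)) x (c * real (q + 2) * norm x ^ q)"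
proof -
  define k where "k = c * real (q + 2)"
  \<comment> \<open>For \<open>q = 0\<close> the truncated exponent \<open>q - 1\<close> is
    harmless, since the factor \<open>real q\<close> vanishes.\<close>
  define A where "A v = k *\<^sub>R (norm x ^ q *\<^sub>R v + (real q * norm x ^ (q - 1) * (v \<bullet> sgn x)) *\<^sub>R x)" for v
  have "0 \<le> k" using assms by (simp add: k_def)
  have grad: "GDERIV (\<lambda>x. c * norm x ^ (q + 2)) y :> k *\<^sub>R (norm y ^ q *\<^sub>R y)" for y :: 'a
    using GDERIV_cmult_norm_power[of c q y] by (simp add: k_def)
  have "GDERIV (\<lambda>x. norm x ^ q) x :> (real q * norm x ^ (q - 1)) *\<^sub>R sgn x"
    using GDERIV_DERIV_compose[OF GDERIV_norm[OF assms(1)] DERIV_pow[of q "norm x"]] by simp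
  from has_derivative_scaleR_right[OF has_derivative_scaleR[OF this[unfolded gderiv_def] has_derivative_ident], of k]
  have "((\<lambda>y. k *\<^sub>R (norm y ^ q *\<^sub>R y)) has_derivative A) (at x)"
    by (simp add: A_def[abs_def] mult_ac)
  then have "has_hessian (\<lambda>x. c * norm x ^ (q + 2)) A x"
    unfolding has_hessian_def using grad by (intro exI[of _ "\<lambda>y. k *\<^sub>R (norm y ^ q *\<^sub>R y)"]) simp
  moreover have "psd (\<lambda>v. A v - (k * norm x ^ q) *\<^sub>R v)"
  proof -
    \<comment> \<open>The coefficient of the rank-one part; the division by the norm comes from
      \<open>sgn x\<close>.\<close>
    define j where "j = k * real q * norm x ^ (q - 1) / norm x"
    have "0 \<le> j" using \<open>0 \<le> k\<close> by (simp add: j_def)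
    have eq: "A v - (k * norm x ^ q) *\<^sub>R v = (j * (v \<bullet> x)) *\<^sub>R x" for v
      by (simp add: A_def j_def sgn_div_norm scaleR_add_right divide_inverse mult_ac)
    show ?thesis unfolding psd_def eq
    proof (intro conjI allI)
      show "linear (\<lambda>v. (j * (v \<bullet> x)) *\<^sub>R x)"
        by (rule linearI) (simp_all add: algebra_simps)
      show "((j * (v \<bullet> x)) *\<^sub>R x) \<bullet> w = v \<bullet> (j * (w \<bullet> x)) *\<^sub>R x" for v w
        by (simp add: inner_commute)
      show "0 \<le> v \<bullet> (j * (v \<bullet> x)) *\<^sub>R x" for v
        using \<open>0 \<le> j\<close> by (simp add: mult.assoc)
    qed
  qed
  ultimately show ?thesis
    unfolding hessian_ge_def loewner_ge_def k_def by blast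
qed

section \<open>Semi-convex functions\<close>

text \<open>Adding \<open>L *\<^sub>R x\<close> to the gradient makes it monotone, so the shifted
  function has a nondecreasing derivative along every line.\<close>

lemma convex_on_gradient_ge:
  fixes f :: "'a::euclidean_space \<Rightarrow> real"
  assumes G: "\<And>x. GDERIV f x :> G x"
    and mono: "\<And>x y. - L * (norm (x - y))\<^sup>2 \<le> (G x - G y) \<bullet> (x - y)"
  shows "convex_on UNIV (\<lambda>x. f x + L / 2 * (norm x)\<^sup>2)"
proof (rule convex_onI)
  let ?f = "\<lambda>x. f x + L / 2 * (norm x)\<^sup>2" and ?G = "\<lambda>x. G x + L *\<^sub>R x"
  fix t :: real and x y :: 'a assume t: "0 < t" "t < 1"
  define d where "d = y - x"
  have G': "GDERIV ?f z :> ?G z" for z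
  proof -
    have "((\<lambda>z. L / 2 * (z \<bullet> z)) has_derivative (\<lambda>h. h \<bullet> (L *\<^sub>R z))) (at z)"
      by (auto intro!: derivative_eq_intros simp: inner_commute algebra_simps)
    then show ?thesis
      unfolding power2_norm_eq_inner by (intro GDERIV_add G) (simp add: gderiv_def)
  qed
  have "convex_on UNIV (\<lambda>s. ?f (x + s *\<^sub>R d))"
  proof (rule convex_on_realI)
    fix s
    have "((\<lambda>s. x + s *\<^sub>R d) has_derivative (\<lambda>h. h *\<^sub>R d)) (at s)"
      by (auto intro!: derivative_eq_intros)
    from has_derivative_compose[OF this G'[unfolded gderiv_def]]
    show "DERIV (\<lambda>s. ?f (x + s *\<^sub>R d)) s :> ?G (x + s *\<^sub>R d) \<bullet> d"
      unfolding has_field_derivative_def by (simp add: inner_commute mult.commute[of _ "_ \<bullet> _"] mult_commute_abs)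
  next
    fix r s :: real assume "r \<le> s"
    have "0 \<le> (s - r) * ((?G (x + s *\<^sub>R d) - ?G (x + r *\<^sub>R d)) \<bullet> d)"
    proof -
      have "(x + s *\<^sub>R d) - (x + r *\<^sub>R d) = (s - r) *\<^sub>R d" by (simp add: algebra_simps)
      then have "- L * (norm ((s - r) *\<^sub>R d))\<^sup>2 \<le> (G (x + s *\<^sub>R d) - G (x + r *\<^sub>R d)) \<bullet> ((s - r) *\<^sub>R d)"
        using mono[of "x + s *\<^sub>R d" "x + r *\<^sub>R d"] by simp
      then show ?thesis
        unfolding power2_norm_eq_inner by (simp add: algebra_simps inner_add_left inner_diff_left)
    qed
    then show "?G (x + r *\<^sub>R d) \<bullet> d \<le> ?G (x + s *\<^sub>R d) \<bullet> d"
      using \<open>r \<le> s\<close> by (cases "r = s") (auto simp: zero_le_mult_iff inner_diff_left)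
  qed simp
  from convex_onD[OF this, of t 0 1] t
  have "?f (x + t *\<^sub>R d) \<le> (1 - t) * ?f x + t * ?f (x + d)" by simp
  moreover have "x + t *\<^sub>R d = (1 - t) *\<^sub>R x + t *\<^sub>R y" "x + d = y"
    by (simp_all add: d_def algebra_simps)
  ultimately show "?f ((1 - t) *\<^sub>R x + t *\<^sub>R y) \<le> (1 - t) * ?f x + t * ?f y" by metis
qed simp

text \<open>With the affine and quadratic terms moved to one side, \<open>x\<close> is a global
  minimiser. The quadratic term has zero derivative at \<open>x\<close>, so stationarity identifies
  \<open>h\<close>.\<close>

lemma semiconvex_subdiff_eq_gradient:
  assumes "GDERIV f x :> g" and h: "h \<in> semiconvex_subdiff L f x"
  shows "h = g"
proof -
  let ?F = "\<lambda>y. f y - h \<bullet> (y - x) + L / 2 * ((y - x) \<bullet> (y - x))"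
  have "(?F has_derivative (\<lambda>v. v \<bullet> g - h \<bullet> v)) (at x)"
    using assms(1)[unfolded gderiv_def] by (auto intro!: derivative_eq_intros)
  moreover have "\<forall>y\<in>UNIV. ?F x \<le> ?F y"
    using h by (auto simp: semiconvex_subdiff_def power2_norm_eq_inner algebra_simps)
  ultimately have "(\<lambda>v. v \<bullet> g - h \<bullet> v) = (\<lambda>v. 0)"
    by (intro differential_zero_maxmin[of x UNIV ?F]) auto
  then have "(g - h) \<bullet> g - h \<bullet> (g - h) = 0" by metis
  then have "(g - h) \<bullet> (g - h) = 0" by (simp add: inner_diff_left inner_diff_right inner_commute)
  then show ?thesis by simp
qed

section \<open>Scalar estimates\<close>

text \<open>The source of the power of 2 in \<open>cbar\<close>. In the induction, 1 - t and 1 -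
  t^(n+1) have the same sign, so their product is nonnegative.\<close>

lemma one_plus_power_le:
  fixes t :: real
  assumes "0 \<le> t" shows "(1 + t) ^ Suc n \<le> 2 ^ n * (1 + t ^ Suc n)"
proof (induction n)
  case (Suc n)
  have "0 \<le> (1 - t) * (1 - t ^ Suc n)"
  proof (cases "t \<le> 1")
    case True
    then show ?thesis using assms power_le_one[of t "Suc n"] by (intro mult_nonneg_nonneg) auto
  next
    case False
    then show ?thesis using one_le_power[of t "Suc n"] by (intro mult_nonpos_nonpos) auto
  qed
  then have *: "(1 + t) * (1 + t ^ Suc n) \<le> 2 * (1 + t ^ Suc (Suc n))" by (simp add: algebra_simps)
  have "(1 + t) ^ Suc (Suc n) \<le> (1 + t) * (2 ^ n * (1 + t ^ Suc n))"
    using mult_left_mono[OF Suc, of "1 + t"] assms by simp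
  also have "\<dots> = 2 ^ n * ((1 + t) * (1 + t ^ Suc n))" by (simp only: mult_ac)
  also have "\<dots> \<le> 2 ^ n * (2 * (1 + t ^ Suc (Suc n)))" by (intro mult_left_mono *) simp
  also have "\<dots> = 2 ^ Suc n * (1 + t ^ Suc (Suc n))" by simp
  finally show ?case .
qed simp

text \<open>The gap between the two sides for n + 1 is s times the gap for n plus a nonnegative
  multiple of (t - s)^2.\<close>

lemma weighted_amgm_power:
  fixes s t :: real
  assumes "0 \<le> s" "0 \<le> t" shows "real (n + 1) * s * t ^ n \<le> real n * t ^ (n + 1) + s ^ (n + 1)"
proof (induction n)
  case (Suc n)
  have "0 \<le> s * (real n * t ^ (n + 1) + s ^ (n + 1) - real (n + 1) * s * t ^ n) + real (n + 1) * t ^ n * (t - s)\<^sup>2"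
    using Suc assms by (intro add_nonneg_nonneg mult_nonneg_nonneg) auto
  also have "\<dots> = real (Suc n) * t ^ (Suc n + 1) + s ^ (Suc n + 1) - real (Suc n + 1) * s * t ^ Suc n"
    by (simp add: power2_eq_square algebra_simps)
  finally show ?case by simp
qed simp

text \<open>The origin of the constant \<open>L\<close>: (a t - b) t^n is minimal at t = n b / ((n +
  1) a), the point called \<open>s\<close> in the proof, with value - b s^n / (n + 1).\<close>

lemma scalar_modulus_ge:
  fixes a b t :: real
  assumes "0 < a" "0 < b" "0 \<le> t" "0 < n"
  shows "- (b * (1 + 1 / real (n + 1) * (real n * b / (real (n + 1) * a)) ^ n)) \<le> (a * t - b) * t ^ n - b"
proof -
  define s where "s = real n * b / (real (n + 1) * a)"
  have "0 \<le> s" using assms by (simp add: s_def)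
  have b: "b * real n = real (n + 1) * a * s" using assms by (simp add: s_def)
  \<comment> \<open>Clearing the factor n (n + 1) allows b n to be replaced by (n + 1) a s, which
    leaves a multiple of the AM-GM gap.\<close>
  have "real (n + 1) * (real n * (b / real (n + 1) * s ^ n + (a * t - b) * t ^ n)) =
      (b * real n) * s ^ n + real (n + 1) * (a * real n * t ^ (n + 1) - (b * real n) * t ^ n)"
    by (simp add: field_simps)
  also have "\<dots> = real (n + 1) * a * (real n * t ^ (n + 1) + s ^ (n + 1) - real (n + 1) * s * t ^ n)"
    unfolding b by (simp add: algebra_simps)
  also have "0 \<le> \<dots>"
    using weighted_amgm_power[OF \<open>0 \<le> s\<close> \<open>0 \<le> t\<close>, of n] assms by (intro mult_nonneg_nonneg) auto
  finally have "0 \<le> b / real (n + 1) * s ^ n + (a * t - b) * t ^ n"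
    using assms by (simp add: zero_le_mult_iff)
  then show ?thesis unfolding s_def[symmetric] by (simp add: algebra_simps)
qed

text \<open>The first entry of the maximum makes b at most half of a t; the second makes the
  remaining a t^(n+1) / 2 at least b + \<open>\<mu>\<close>.\<close>

lemma scalar_modulus_ge_outside:
  fixes a b t \<mu> :: real
  assumes "0 < a" "0 < b" "0 < \<mu>"
    and t: "max (2 * b / a) ((2 * (b + \<mu>) / a) powr (1 / real (n + 1))) \<le> t"
  shows "\<mu> \<le> (a * t - b) * t ^ n - b"
proof -
  have "0 < 2 * b / a" using assms by simp
  with t have "0 < t" by linarith
  have half: "a * t / 2 \<le> a * t - b" using t assms by (simp add: field_simps)
  have "(2 * (b + \<mu>) / a) powr (1 / real (n + 1)) \<le> t" using t by simp
  then have "((2 * (b + \<mu>) / a) powr (1 / real (n + 1))) ^ (n + 1) \<le> t ^ (n + 1)"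
    by (intro power_mono) auto
  moreover have "((2 * (b + \<mu>) / a) powr (1 / real (n + 1))) ^ (n + 1) = 2 * (b + \<mu>) / a"
    using assms by (subst powr_realpow[symmetric]) (simp_all add: powr_powr)
  ultimately have "2 * (b + \<mu>) / a \<le> t ^ (n + 1)" by metis
  then have "b + \<mu> \<le> a * t / 2 * t ^ n"
    using assms by (simp add: field_simps)
  also have "\<dots> \<le> (a * t - b) * t ^ n"
    using half \<open>0 < t\<close> by (intro mult_right_mono) auto
  finally show ?thesis by simp
qed

section \<open>Bounds for the regularised potential\<close>

theorem proposition8:
  fixes \<epsilon> \<tau> c\<^sub>q\<^sub>k :: real and T :: nat
    and R :: "nat \<Rightarrow> real ^ 'k::finite ^ 'k"
    and S :: "'l::{finite,linorder} \<Rightarrow> nat \<Rightarrow> nat set"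
    and D :: "'v::finite list pmf"
    and u uhat :: "('l, 'v, 'h::finite, 'k) params \<Rightarrow> real"
    and cstar cbar \<eta> L :: real and \<rho> :: "real \<Rightarrow> real"
  assumes "0 < \<epsilon>" and "0 < \<tau>" and "0 < c\<^sub>q\<^sub>k" and "1 \<le> T"
    and "\<And>t. t < T \<Longrightarrow> orthogonal_matrix (R t)"
    and "\<And>l t. t < T \<Longrightarrow> S l t \<subseteq> {0..t} \<and> S l t \<noteq> {}"
    and "set_pmf D \<subseteq> {x. length x = T + 1}"
    and "u = potential \<epsilon> \<tau> c\<^sub>q\<^sub>k R S T D"
    and "0 < cstar"
    and "AE \<theta> in lborel. hessian_ge u \<theta> (- cstar * (1 + norm \<theta>) ^ (12 * CARD('l) + 2))"
    and "cbar = 2 ^ (12 * CARD('l) + 1) * cstar"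
    and "0 < \<eta>"
    and "uhat = (\<lambda>\<theta>. u \<theta> + \<eta> * norm \<theta> ^ (12 * CARD('l) + 5))"
    and "L = cbar * (1 + 1 / real (12 * CARD('l) + 3) *
               (real (12 * CARD('l) + 2) * cbar /
                (real (12 * CARD('l) + 3) * \<eta> * real (12 * CARD('l) + 5))) ^ (12 * CARD('l) + 2))"
    and "\<rho> = (\<lambda>\<mu>. max (2 * cbar / (\<eta> * real (12 * CARD('l) + 5)))
               ((2 * (cbar + \<mu>) / (\<eta> * real (12 * CARD('l) + 5)))
                  powr (1 / real (12 * CARD('l) + 3))))"
  shows "(AE \<theta> in lborel. hessian_ge uhat \<theta>
            ((\<eta> * real (12 * CARD('l) + 5) * norm \<theta> - cbar) * norm \<theta> ^ (12 * CARD('l) + 2) - cbar))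
       \<and> convex_on UNIV (\<lambda>\<theta>. uhat \<theta> + L / 2 * (norm \<theta>)\<^sup>2)
       \<and> (\<forall>\<mu>>0. AE \<theta> in lborel. norm \<theta> \<ge> \<rho> \<mu> \<longrightarrow> hessian_ge uhat \<theta> \<mu>)
       \<and> (\<forall>\<mu>>0. \<forall>h. (\<forall>\<theta>. h \<theta> \<in> semiconvex_subdiff L uhat \<theta>) \<longrightarrow>
            (\<forall>\<theta> \<theta>'. norm (\<theta> - \<theta>') \<ge> 4 * \<rho> \<mu> * (\<mu> + L) / \<mu> \<longrightarrow>
               (h \<theta> - h \<theta>') \<bullet> (\<theta> - \<theta>') \<ge> \<mu> / 2 * (norm (\<theta> - \<theta>'))\<^sup>2))"
proof -
  \<comment> \<open>Here \<open>n\<close> is the growth exponent in the bound for \<open>u\<close>,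
    and \<open>a\<close> is the coefficient that the regulariser contributes to its gradient and
    Hessian bound.\<close>
  define n where "n = 12 * CARD('l) + 2"
  define a where "a = \<eta> * real (n + 3)"
  have n: "12 * CARD('l) + 1 = n - 1" "12 * CARD('l) + 2 = n" "12 * CARD('l) + 3 = n + 1"
      "12 * CARD('l) + 5 = n + 3" "Suc (n - 1) = n" "0 < n"
    by (simp_all add: n_def)
  \<comment> \<open>Fits the regulariser to the exponent \<open>q + 2\<close> of the norm power
    lemmas, with \<open>n + 1\<close> for \<open>q\<close>.\<close>
  have q: "n + 1 + 2 = n + 3" by simp
  have u: "u = potential \<epsilon> \<tau> c\<^sub>q\<^sub>k R S T D" by fact
  have hess_u: "AE \<theta> in lborel. hessian_ge u \<theta> (- cstar * (1 + norm \<theta>) ^ n)"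
    using assms(10) unfolding n .
  have cbar: "cbar = 2 ^ (n - 1) * cstar" using assms(11) unfolding n .
  have uhat: "uhat = (\<lambda>\<theta>. u \<theta> + \<eta> * norm \<theta> ^ (n + 3))" using assms(13) unfolding n .
  have L: "L = cbar * (1 + 1 / real (n + 1) * (real n * cbar / (real (n + 1) * a)) ^ n)"
    using assms(14) unfolding n by (simp only: a_def mult.assoc)
  have \<rho>: "\<rho> \<mu> = max (2 * cbar / a) ((2 * (cbar + \<mu>) / a) powr (1 / real (n + 1)))" for \<mu>
    using assms(15) unfolding n by (simp only: a_def)
  have pos: "0 < cbar" "0 < a" using \<open>0 < cstar\<close> \<open>0 < \<eta>\<close> by (simp_all add: cbar a_def)
  then have "0 < L" unfolding L by (intro mult_pos_pos add_pos_nonneg) auto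

  have "C11 u"
    unfolding u using assms(1,6,7) by (intro C11_potential) auto
  then obtain G\<^sub>u where G\<^sub>u: "\<And>\<theta>. GDERIV u \<theta> :> G\<^sub>u \<theta>" "ball_lipschitz G\<^sub>u"
    unfolding C11_def by blast
  define G where "G \<theta> = G\<^sub>u \<theta> + (a * norm \<theta> ^ (n + 1)) *\<^sub>R \<theta>" for \<theta>
  have G: "GDERIV uhat \<theta> :> G \<theta>" for \<theta>
  proof -
    have "GDERIV (\<lambda>\<theta>. \<eta> * norm \<theta> ^ (n + 3)) \<theta> :> (a * norm \<theta> ^ (n + 1)) *\<^sub>R \<theta>"
      using GDERIV_cmult_norm_power[of \<eta> "n + 1" \<theta>] unfolding q a_def .
    from GDERIV_add[OF G\<^sub>u(1) this] show ?thesis unfolding uhat G_def .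
  qed
  have "ball_lipschitz G"
    unfolding G_def[abs_def] by (intro ball_lipschitz_add G\<^sub>u(2) ball_lipschitz_norm_power_gradient)

  \<comment> \<open>The Hessian of the norm power was computed only away from the origin, which is a
    null set.\<close>
  have "AE \<theta> in lborel. \<theta> \<noteq> (0 :: ('l, 'v, 'h, 'k) params)"
    by (rule AE_lborel_singleton)
  with hess_u have hess: "AE \<theta> in lborel. hessian_ge uhat \<theta> ((a * norm \<theta> - cbar) * norm \<theta> ^ n - cbar)"
  proof eventually_elim
    case (elim \<theta>)
    have "hessian_ge (\<lambda>\<theta>. \<eta> * norm \<theta> ^ (n + 3)) \<theta> (a * norm \<theta> ^ (n + 1))"
      using hessian_ge_norm_power[OF elim(2), of \<eta> "n + 1"] \<open>0 < \<eta>\<close> unfolding q a_def by simp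
    from hessian_ge_add[OF elim(1) this]
    have "hessian_ge uhat \<theta> (- cstar * (1 + norm \<theta>) ^ n + a * norm \<theta> ^ (n + 1))"
      unfolding uhat .
    moreover have "cstar * (1 + norm \<theta>) ^ n \<le> cstar * (2 ^ (n - 1) * (1 + norm \<theta> ^ n))"
      using one_plus_power_le[of "norm \<theta>" "n - 1"] \<open>0 < cstar\<close> unfolding n(5) by (intro mult_left_mono) auto
    then have "(a * norm \<theta> - cbar) * norm \<theta> ^ n - cbar \<le> - cstar * (1 + norm \<theta>) ^ n + a * norm \<theta> ^ (n + 1)"
      by (simp add: cbar algebra_simps)
    ultimately show ?case by (rule hessian_ge_mono)
  qed
  have hess_L: "AE \<theta> in lborel. hessian_ge uhat \<theta> (- L)"
    using hess
  proof eventually_elim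
    case (elim \<theta>)
    then show ?case
      by (rule hessian_ge_mono) (use scalar_modulus_ge[of a cbar "norm \<theta>" n] pos n(6) in \<open>simp only: L norm_ge_zero\<close>)
  qed
  have hess_\<mu>: "AE \<theta> in lborel. norm \<theta> \<ge> \<rho> \<mu> \<longrightarrow> hessian_ge uhat \<theta> \<mu>" if "0 < \<mu>" for \<mu>
    using hess
  proof eventually_elim
    case (elim \<theta>)
    show ?case
    proof
      assume "\<rho> \<mu> \<le> norm \<theta>"
      then show "hessian_ge uhat \<theta> \<mu>"
        by (intro hessian_ge_mono[OF elim] scalar_modulus_ge_outside) (use pos that \<rho> in simp_all)
    qed
  qed

  have convex: "convex_on UNIV (\<lambda>\<theta>. uhat \<theta> + L / 2 * (norm \<theta>)\<^sup>2)"
  proof (rule convex_on_gradient_ge[OF G])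
    have "AE \<theta> in lborel. derivative_ge G (- L) \<theta>"
      using hess_L by eventually_elim (rule hessian_ge_imp_derivative_ge[OF _ G])
    then show "- L * (norm (\<theta> - \<theta>'))\<^sup>2 \<le> (G \<theta> - G \<theta>') \<bullet> (\<theta> - \<theta>')" for \<theta> \<theta>'
      by (rule gradient_increment_ge[OF \<open>ball_lipschitz G\<close>])
  qed

  have strong: "\<mu> / 2 * (norm (\<theta> - \<theta>'))\<^sup>2 \<le> (h \<theta> - h \<theta>') \<bullet> (\<theta> - \<theta>')"
    if "0 < \<mu>" and h: "\<And>\<theta>. h \<theta> \<in> semiconvex_subdiff L uhat \<theta>"
      and far: "4 * \<rho> \<mu> * (\<mu> + L) / \<mu> \<le> norm (\<theta> - \<theta>')" for \<mu> h \<theta> \<theta>'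
  proof -
    have "0 \<le> \<rho> \<mu>" using pos unfolding \<rho> by (simp add: le_max_iff_disj)
    \<comment> \<open>The two almost everywhere bounds merge into one modulus that jumps at the
      sphere of radius \<open>\<rho> \<mu>\<close>.\<close>
    have "AE \<theta> in lborel. derivative_ge G (if \<rho> \<mu> \<le> norm \<theta> then \<mu> else - L) \<theta>"
      using hess_L hess_\<mu>[OF \<open>0 < \<mu>\<close>]
      by eventually_elim (simp add: hessian_ge_imp_derivative_ge[OF _ G])
    from gradient_increment_ge_outside_ball[OF \<open>ball_lipschitz G\<close> \<open>0 \<le> \<rho> \<mu>\<close> _ this]
    have "\<mu> * (norm (\<theta> - \<theta>'))\<^sup>2 - 2 * \<rho> \<mu> * (\<mu> + L) * norm (\<theta> - \<theta>') \<le> (G \<theta> - G \<theta>') \<bullet> (\<theta> - \<theta>')"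
      using \<open>0 < \<mu>\<close> \<open>0 < L\<close> by simp
    \<comment> \<open>The separation threshold is exactly what makes the loss inside the ball at
      most half of the gain.\<close>
    moreover have "2 * \<rho> \<mu> * (\<mu> + L) \<le> \<mu> / 2 * norm (\<theta> - \<theta>')"
      using far \<open>0 < \<mu>\<close> by (simp add: field_simps)
    then have "2 * \<rho> \<mu> * (\<mu> + L) * norm (\<theta> - \<theta>') \<le> \<mu> / 2 * norm (\<theta> - \<theta>') * norm (\<theta> - \<theta>')"
      by (intro mult_right_mono) auto
    moreover have "h = G"
      using semiconvex_subdiff_eq_gradient[OF G h] by blast
    ultimately show ?thesis by (simp add: power2_eq_square)
  qed

  show ?thesis
    unfolding n
    using hess convex hess_\<mu> strong by (auto simp: a_def)
qed

end
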